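(* If $G$ is a finite, simple and connected graph, then $\mathbb{H}(\mathrm{Cone}(G))\cong\mathbb{H}(G)$ (isomorphism of graded vector spaces, $\mathbb{H}$ denoting bold homology with coefficients in a field).
   Context: The graph cone $\mathrm{Cone}(G)$ is the graph obtained from $G$ by adding one extra vertex $\hat v$ and one edge between $\hat v$ and each $v\in V(G)$. Bold homology. Let $G$ be a finite simple graph and $\mathbb{K}$ a field; order $V(G)$. A bi-colouring is a map $\varepsilon\colon V(G)\to\{0,1\}$, and $G_\varepsilon$ denotes the subgraph of $G$ induced by the vertices $v$ with $\varepsilon(v)=1$. Write $\varepsilon\,\widetilde{\triangleleft}\,\varepsilon'$ if $\varepsilon'$ is obtained from $\varepsilon$ by changing the value at exactly one vertex from $0$ to $1$. A sign assignment is a choice of $s(\varepsilon,\varepsilon')\in\mathbb{Z}/2$ for each such pair with $s(\varepsilon,\varepsilon_1)+s(\varepsilon_1,\varepsilon'')\equiv s(\varepsilon,\varepsilon_2)+s(\varepsilon_2,\varepsilon'')+1\pmod 2$ whenever $\varepsilon\,\widetilde{\triangleleft}\,\varepsilon_1,\varepsilon_2\,\widetilde{\triangleleft}\,\varepsilon''$, $\varepsilon_1\neq\varepsilon_2$; it exists and the choice does not affect the complex up to isomorphism. The bold chain group is \[\mathrm{C}\mathbb{H}_i(G)=\bigoplus_{\varepsilon:\ \sum_v\varepsilon(v)=i}\ \bigoplus_{x\in\pi_0(G_\varepsilon)}\mathbb{K}\langle x\rangle,\] where $\pi_0$ is the set of connected components (so $\mathrm{C}\mathbb{H}_0=0$),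 with differential $d^i\colon \mathrm{C}\mathbb{H}_i\to\mathrm{C}\mathbb{H}_{i+1}$ given for $x\in\pi_0(G_\varepsilon)$ by $d^i(x)=\sum(-1)^{s(\varepsilon,\varepsilon')}y$, the sum over all $\varepsilon'$ with $\varepsilon\,\widetilde{\triangleleft}\,\varepsilon'$ and the component $y\in\pi_0(G_{\varepsilon'})$ with $V(x)\subseteq V(y)$. Its homology is the bold homology $\mathbb{H}_*(G)$. Connected graphs are non-empty. *)

theory Defs
  imports
    "Graph_Theory.Graph_Theory"
    "HOL-Library.FuncSet"
    "HOL-Library.Poly_Mapping"
    "HOL-Library.Z2"
begin

text \<open>
  A finite simple graph is a \<open>pair_graph\<close>: each undirected edge is stored as a pair of opposite
  arcs.
\<close>

definition cone :: "'a pair_pre_digraph \<Rightarrow> 'a option pair_pre_digraph" where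
  "cone G = \<lparr>pverts = insert None (Some ` pverts G),
             parcs = {(Some u, Some v) | u v. (u, v) \<in> parcs G}
                   \<union> {(None, Some v) | v. v \<in> pverts G}
                   \<union> {(Some v, None) | v. v \<in> pverts G}\<rparr>"

lemma pair_graph_cone:
  assumes "pair_graph G"
  shows "pair_graph (cone G)"
proof -
  interpret pair_graph G by fact
  have "parcs (cone G) \<subseteq> pverts (cone G) \<times> pverts (cone G)"
    by (auto simp: cone_def dest: wellformed')
  then have fin: "finite (parcs (cone G))"
    by (rule finite_subset) (simp add: cone_def)
  have arc_sym: "(v, u) \<in> parcs G" if "(u, v) \<in> parcs G" for u v
    using pair_sym_arcs that by (simp add: symmetric_def sym_def)
  have "symmetric (cone G)"
    unfolding symmetric_def with_proj_simps by (rule symI) (auto simp: cone_def intro: arc_sym)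
  with fin show ?thesis
    by unfold_locales (auto simp: cone_def dest: wellformed' no_loops)
qed

text \<open>A connected component is represented by its vertex set, which determines it.\<close>

definition components :: "('a, 'b) pre_digraph \<Rightarrow> 'a set set" where
  "components H = verts ` {C. pre_digraph.max_subgraph H connected C}"

definition bicolourings :: "'a pair_pre_digraph \<Rightarrow> ('a \<Rightarrow> nat) set" where
  "bicolourings G = pverts G \<rightarrow>\<^sub>E {0, 1}"

definition coloured_subgraph ::
  "'a pair_pre_digraph \<Rightarrow> ('a \<Rightarrow> nat) \<Rightarrow> ('a, 'a \<times> 'a) pre_digraph" where
  "coloured_subgraph G \<epsilon> = with_proj G \<restriction> {v \<in> pverts G. \<epsilon> v = 1}"

definition flips :: "'a pair_pre_digraph \<Rightarrow> ('a \<Rightarrow> nat) \<Rightarrow> ('a \<Rightarrow> nat) \<Rightarrow> bool" where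
  "flips G \<epsilon> \<epsilon>' \<longleftrightarrow> \<epsilon> \<in> bicolourings G \<and> (\<exists>v \<in> pverts G. \<epsilon> v = 0 \<and> \<epsilon>' = \<epsilon>(v := 1))"

text \<open>The type \<open>bit\<close> is the field with two elements.\<close>

definition sign_assignment ::
  "'a pair_pre_digraph \<Rightarrow> (('a \<Rightarrow> nat) \<Rightarrow> ('a \<Rightarrow> nat) \<Rightarrow> bit) \<Rightarrow> bool" where
  "sign_assignment G s \<longleftrightarrow>
     (\<forall>\<epsilon> \<epsilon>\<^sub>1 \<epsilon>\<^sub>2 \<epsilon>''.
        flips G \<epsilon> \<epsilon>\<^sub>1 \<and> flips G \<epsilon> \<epsilon>\<^sub>2 \<and> flips G \<epsilon>\<^sub>1 \<epsilon>'' \<and> flips G \<epsilon>\<^sub>2 \<epsilon>'' \<and> \<epsilon>\<^sub>1 \<noteq> \<epsilon>\<^sub>2 \<longrightarrow>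
        s \<epsilon> \<epsilon>\<^sub>1 + s \<epsilon>\<^sub>1 \<epsilon>'' = s \<epsilon> \<epsilon>\<^sub>2 + s \<epsilon>\<^sub>2 \<epsilon>'' + 1)"

type_synonym 'a generator = "('a \<Rightarrow> nat) \<times> 'a set"

definition generators :: "'a pair_pre_digraph \<Rightarrow> nat \<Rightarrow> 'a generator set" where
  "generators G i = {(\<epsilon>, x). \<epsilon> \<in> bicolourings G \<and> (\<Sum>v \<in> pverts G. \<epsilon> v) = i
                            \<and> x \<in> components (coloured_subgraph G \<epsilon>)}"

definition bold_chains :: "'a pair_pre_digraph \<Rightarrow> nat \<Rightarrow> ('a generator \<Rightarrow>\<^sub>0 'k::field) set" where
  "bold_chains G i = {c. Poly_Mapping.keys c \<subseteq> generators G i}"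

definition scale :: "'k::field \<Rightarrow> ('g \<Rightarrow>\<^sub>0 'k) \<Rightarrow> ('g \<Rightarrow>\<^sub>0 'k)" where
  "scale a c = Poly_Mapping.map ((*) a) c"

definition bold_diff_gen ::
  "'a pair_pre_digraph \<Rightarrow> (('a \<Rightarrow> nat) \<Rightarrow> ('a \<Rightarrow> nat) \<Rightarrow> bit) \<Rightarrow> 'a generator
     \<Rightarrow> ('a generator \<Rightarrow>\<^sub>0 'k::field)" where
  "bold_diff_gen G s = (\<lambda>(\<epsilon>, x).
     \<Sum>(\<epsilon>', y) \<in> {(\<epsilon>', y). flips G \<epsilon> \<epsilon>' \<and> y \<in> components (coloured_subgraph G \<epsilon>') \<and> x \<subseteq> y}.
       Poly_Mapping.single (\<epsilon>', y) (if s \<epsilon> \<epsilon>' = 0 then 1 else - 1))"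

definition bold_diff ::
  "'a pair_pre_digraph \<Rightarrow> (('a \<Rightarrow> nat) \<Rightarrow> ('a \<Rightarrow> nat) \<Rightarrow> bit) \<Rightarrow> ('a generator \<Rightarrow>\<^sub>0 'k::field)
     \<Rightarrow> ('a generator \<Rightarrow>\<^sub>0 'k)" where
  "bold_diff G s c = (\<Sum>g \<in> Poly_Mapping.keys c. scale (Poly_Mapping.lookup c g) (bold_diff_gen G s g))"

definition bold_cycles ::
  "'a pair_pre_digraph \<Rightarrow> (('a \<Rightarrow> nat) \<Rightarrow> ('a \<Rightarrow> nat) \<Rightarrow> bit) \<Rightarrow> nat
     \<Rightarrow> ('a generator \<Rightarrow>\<^sub>0 'k::field) set" where
  "bold_cycles G s i = {c \<in> bold_chains G i. bold_diff G s c = 0}"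

definition bold_boundaries ::
  "'a pair_pre_digraph \<Rightarrow> (('a \<Rightarrow> nat) \<Rightarrow> ('a \<Rightarrow> nat) \<Rightarrow> bit) \<Rightarrow> nat
     \<Rightarrow> ('a generator \<Rightarrow>\<^sub>0 'k::field) set" where
  "bold_boundaries G s i = (case i of 0 \<Rightarrow> {0} | Suc j \<Rightarrow> bold_diff G s ` bold_chains G j)"

record ('k, 'v) vec_space =
  vcarrier :: "'v set"
  vadd :: "'v \<Rightarrow> 'v \<Rightarrow> 'v"
  vscale :: "'k \<Rightarrow> 'v \<Rightarrow> 'v"

text \<open>
  The quotient of a subspace \<open>Z\<close> by a subspace \<open>B \<subseteq> Z\<close>, with its elements as cosets. Adding \<open>B\<close> in
  the scalar multiplication makes the result a full coset also for the scalar 0.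
\<close>

definition quotient_space ::
  "('g \<Rightarrow>\<^sub>0 'k::field) set \<Rightarrow> ('g \<Rightarrow>\<^sub>0 'k) set \<Rightarrow> ('k, ('g \<Rightarrow>\<^sub>0 'k) set) vec_space" where
  "quotient_space Z B =
     \<lparr>vcarrier = Z // {(z, z'). z \<in> Z \<and> z' \<in> Z \<and> z - z' \<in> B},
      vadd = (\<lambda>X Y. {x + y | x y. x \<in> X \<and> y \<in> Y}),
      vscale = (\<lambda>a X. {scale a x + b | x b. x \<in> X \<and> b \<in> B})\<rparr>"

definition bold_homology ::
  "'a pair_pre_digraph \<Rightarrow> (('a \<Rightarrow> nat) \<Rightarrow> ('a \<Rightarrow> nat) \<Rightarrow> bit) \<Rightarrow> nat
     \<Rightarrow> ('k::field, ('a generator \<Rightarrow>\<^sub>0 'k) set) vec_space" where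
  "bold_homology G s i = quotient_space (bold_cycles G s i) (bold_boundaries G s i)"

definition linear_iso :: "('k, 'v) vec_space \<Rightarrow> ('k, 'w) vec_space \<Rightarrow> ('v \<Rightarrow> 'w) \<Rightarrow> bool" where
  "linear_iso V W \<phi> \<longleftrightarrow>
     bij_betw \<phi> (vcarrier V) (vcarrier W) \<and>
     (\<forall>x \<in> vcarrier V. \<forall>y \<in> vcarrier V. \<phi> (vadd V x y) = vadd W (\<phi> x) (\<phi> y)) \<and>
     (\<forall>a. \<forall>x \<in> vcarrier V. \<phi> (vscale V a x) = vscale W a (\<phi> x))"

definition graded_isomorphic ::
  "(nat \<Rightarrow> ('k, 'v) vec_space) \<Rightarrow> (nat \<Rightarrow> ('k, 'w) vec_space) \<Rightarrow> bool" where
  "graded_isomorphic V W \<longleftrightarrow> (\<forall>i. \<exists>\<phi>. linear_iso (V i) (W i) \<phi>)"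

text \<open>The standard sign: count the vertices of colour 1 that precede the flipped one.\<close>

lemma sign_assignment_exists:
  assumes "finite (pverts G)"
  shows "\<exists>s. sign_assignment G s"
proof -
  from finite_imp_inj_to_nat_seg[OF assms]
  obtain f :: "'a \<Rightarrow> nat" and n where inj: "inj_on f (pverts G)"
    by (elim exE conjE)
  define N where "N \<epsilon> v = card {w \<in> pverts G. \<epsilon> w = 1 \<and> f w < f v}" for \<epsilon> :: "'a \<Rightarrow> nat" and v
  define s :: "('a \<Rightarrow> nat) \<Rightarrow> ('a \<Rightarrow> nat) \<Rightarrow> bit"
    where "s \<epsilon> \<epsilon>' = of_nat (N \<epsilon> (THE v. \<epsilon> v \<noteq> \<epsilon>' v))" for \<epsilon> \<epsilon>'
  have s_upd: "s \<epsilon> (\<epsilon>(v := 1)) = of_nat (N \<epsilon> v)" if "\<epsilon> v = 0" for \<epsilon> v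
  proof -
    have "(THE w. \<epsilon> w \<noteq> (\<epsilon>(v := 1)) w) = v"
    proof (rule the_equality)
      show "\<epsilon> v \<noteq> (\<epsilon>(v := 1)) v" using that by simp
      show "w = v" if "\<epsilon> w \<noteq> (\<epsilon>(v := 1)) w" for w
        using that by (metis fun_upd_other)
    qed
    then show ?thesis unfolding s_def by (rule arg_cong)
  qed
  have N_upd: "N (\<epsilon>(v := 1)) w = N \<epsilon> w + (if f v < f w then 1 else 0)"
    if "\<epsilon> v = 0" "v \<in> pverts G" for \<epsilon> v w
  proof (cases "f v < f w")
    case True
    then have eq: "{u \<in> pverts G. (\<epsilon>(v := 1)) u = 1 \<and> f u < f w} =
        insert v {u \<in> pverts G. \<epsilon> u = 1 \<and> f u < f w}"
      using that(2) by (auto simp del: One_nat_def)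
    have "v \<notin> {u \<in> pverts G. \<epsilon> u = 1 \<and> f u < f w}" using that(1) by simp
    moreover have "finite {u \<in> pverts G. \<epsilon> u = 1 \<and> f u < f w}" using assms by simp
    ultimately have "card (insert v {u \<in> pverts G. \<epsilon> u = 1 \<and> f u < f w}) =
        card {u \<in> pverts G. \<epsilon> u = 1 \<and> f u < f w} + 1"
      by (subst card_insert_disjoint) (assumption | simp)+
    then show ?thesis unfolding N_def eq using True by (simp only: if_True)
  next
    case False
    have "{u \<in> pverts G. (\<epsilon>(v := 1)) u = 1 \<and> f u < f w} =
        {u \<in> pverts G. \<epsilon> u = 1 \<and> f u < f w}"
    proof (rule Collect_cong)
      show "u \<in> pverts G \<and> (\<epsilon>(v := 1)) u = 1 \<and> f u < f w
              \<longleftrightarrow> u \<in> pverts G \<and> \<epsilon> u = 1 \<and> f u < f w" for u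
        using False by (cases "u = v") simp_all
    qed
    then show ?thesis unfolding N_def using False by (simp only: if_False add_0_right)
  qed
  have "s \<epsilon> \<epsilon>\<^sub>1 + s \<epsilon>\<^sub>1 \<epsilon>'' = s \<epsilon> \<epsilon>\<^sub>2 + s \<epsilon>\<^sub>2 \<epsilon>'' + 1"
    if "flips G \<epsilon> \<epsilon>\<^sub>1" "flips G \<epsilon> \<epsilon>\<^sub>2" "flips G \<epsilon>\<^sub>1 \<epsilon>''" "flips G \<epsilon>\<^sub>2 \<epsilon>''" "\<epsilon>\<^sub>1 \<noteq> \<epsilon>\<^sub>2" for \<epsilon> \<epsilon>\<^sub>1 \<epsilon>\<^sub>2 \<epsilon>''
  proof -
    from that(1) obtain v where v: "v \<in> pverts G" "\<epsilon> v = 0" "\<epsilon>\<^sub>1 = \<epsilon>(v := 1)"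
      by (auto simp: flips_def)
    from that(2) obtain w where w: "w \<in> pverts G" "\<epsilon> w = 0" "\<epsilon>\<^sub>2 = \<epsilon>(w := 1)"
      by (auto simp: flips_def)
    have vw: "v \<noteq> w" using that(5) v w by auto
    from that(3) obtain w' where w': "\<epsilon>\<^sub>1 w' = 0" "\<epsilon>'' = \<epsilon>\<^sub>1(w' := 1)"
      by (auto simp: flips_def)
    from that(4) obtain v' where v': "\<epsilon>\<^sub>2 v' = 0" "\<epsilon>'' = \<epsilon>\<^sub>2(v' := 1)"
      by (auto simp: flips_def)
    have ww: "w' = w"
    proof (rule ccontr)
      assume "w' \<noteq> w"
      then have "\<epsilon>'' w = 0" unfolding w'(2) v(3) using w(2) vw by simp
      moreover have "\<epsilon>'' w \<noteq> 0" unfolding v'(2) w(3) by simp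
      ultimately show False by contradiction
    qed
    have vv: "v' = v"
    proof (rule ccontr)
      assume "v' \<noteq> v"
      then have "\<epsilon>'' v = 0" unfolding v'(2) w(3) using v(2) vw by simp
      moreover have "\<epsilon>'' v \<noteq> 0" unfolding w'(2) v(3) by simp
      ultimately show False by contradiction
    qed
    have up: "\<epsilon>'' = \<epsilon>\<^sub>1(w := 1)" "\<epsilon>'' = \<epsilon>\<^sub>2(v := 1)"
      using w'(2) v'(2) unfolding ww vv by this+
    have sums: "s \<epsilon> \<epsilon>\<^sub>1 = of_nat (N \<epsilon> v)" "s \<epsilon> \<epsilon>\<^sub>2 = of_nat (N \<epsilon> w)"
      "s \<epsilon>\<^sub>1 \<epsilon>'' = of_nat (N \<epsilon>\<^sub>1 w)" "s \<epsilon>\<^sub>2 \<epsilon>'' = of_nat (N \<epsilon>\<^sub>2 v)"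
      subgoal unfolding v(3) using v(2) by (rule s_upd)
      subgoal unfolding w(3) using w(2) by (rule s_upd)
      subgoal unfolding up(1) using w'(1) unfolding ww by (rule s_upd)
      subgoal unfolding up(2) using v'(1) unfolding vv by (rule s_upd)
      done
    have N1: "N \<epsilon>\<^sub>1 w = N \<epsilon> w + (if f v < f w then 1 else 0)"
      unfolding v(3) using v(2,1) by (rule N_upd)
    have N2: "N \<epsilon>\<^sub>2 v = N \<epsilon> v + (if f w < f v then 1 else 0)"
      unfolding w(3) using w(2,1) by (rule N_upd)
    have bits: "a + (b + 1) = b + a + 1" "a + b = b + (a + 1) + 1" for a b :: bit
      by (cases a; cases b; simp)+
    have "f v \<noteq> f w" using inj v(1) w(1) vw by (meson inj_onD)
    then consider (lt) "f v < f w" "\<not> f w < f v" | (gt) "f w < f v" "\<not> f v < f w" by linarith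
    then show ?thesis
    proof cases
      case lt
      show ?thesis
        unfolding sums N1 N2 of_nat_add if_P[OF lt(1)] if_not_P[OF lt(2)] of_nat_1 of_nat_0
          add_0_right by (rule bits(1))
    next
      case gt
      show ?thesis
        unfolding sums N1 N2 of_nat_add if_P[OF gt(1)] if_not_P[OF gt(2)] of_nat_1 of_nat_0
          add_0_right by (rule bits(2))
    qed
  qed
  then show ?thesis unfolding sign_assignment_def by blast
qed

end

theory Submission
  imports Defs
begin

text \<open>
  Split the colourings of the cone according to the colour of the apex \<open>None\<close>. Changing colours from
  0 to 1 never switches the apex off, so the colourings with apex colour 1 span a subcomplex, and the
  quotient by it is spanned by the colourings with apex colour 0. The latter are the colourings of
  \<open>G\<close>, with the same coloured subgraphs and in the same degrees, so the quotient is the complex of \<open>G\<close>.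

  The subcomplex is acyclic. Every coloured subgraph that contains the apex is connected
  (\<open>components_apex_coloured\<close>), so there is one generator for each colouring of the vertices of \<open>G\<close>, and
  the subcomplex is the cochain complex of a full cube. As \<open>G\<close> has a vertex \<open>p\<close>, the cube has a
  direction in which it can be contracted (\<open>apex_contraction_homotopy\<close>). A surjective chain map with
  acyclic kernel induces an isomorphism of homology (\<open>linear_iso_homology\<close>), which gives the theorem.

  The two sign assignments, on \<open>G\<close> and on the cone, are arbitrary and unrelated. The sign assignment of
  the cone restricts to one of \<open>G\<close>, and any two sign assignments differ by the coboundary of a function
  on colourings (\<open>sign_assignments_differ_by_coboundary\<close>); rescaling the generators by this function
  makes the projection onto the quotient a chain map.
\<close>

section \<open>Linear maps on spaces of chains\<close>

lemma lookup_scale [simp]: "Poly_Mapping.lookup (scale a c) g = a * Poly_Mapping.lookup c g"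
  unfolding scale_def by transfer (simp add: when_def)

interpretation chain: vector_space scale
  by unfold_locales (rule poly_mapping_eqI; simp add: lookup_add algebra_simps)+

interpretation chain: vector_space_pair scale scale ..

abbreviation chain_linear :: "(('g \<Rightarrow>\<^sub>0 'k::field) \<Rightarrow> ('h \<Rightarrow>\<^sub>0 'k)) \<Rightarrow> bool" where
  "chain_linear \<equiv> Vector_Spaces.linear scale scale"

definition chains_on :: "'g set \<Rightarrow> ('g \<Rightarrow>\<^sub>0 'k::field) set" where
  "chains_on S = {c. Poly_Mapping.keys c \<subseteq> S}"

definition linear_extension ::
  "('g \<Rightarrow> ('h \<Rightarrow>\<^sub>0 'k::field)) \<Rightarrow> ('g \<Rightarrow>\<^sub>0 'k) \<Rightarrow> ('h \<Rightarrow>\<^sub>0 'k)" where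
  "linear_extension f c =
     (\<Sum>g \<in> Poly_Mapping.keys c. scale (Poly_Mapping.lookup c g) (f g))"

lemma subspace_chains_on: "chain.subspace (chains_on S)"
  by (rule chain.subspaceI)
    (auto simp: chains_on_def in_keys_iff lookup_add subset_iff, metis add.right_neutral)

lemma single_in_chains_on: "g \<in> S \<Longrightarrow> Poly_Mapping.single g a \<in> chains_on S"
  by (auto simp: chains_on_def split: if_splits)

lemma chain_expansion:
  "c = (\<Sum>g \<in> Poly_Mapping.keys c. scale (Poly_Mapping.lookup c g) (Poly_Mapping.single g 1))"
proof (rule poly_mapping_eqI)
  fix k
  have "(\<Sum>g\<in>Poly_Mapping.keys c. Poly_Mapping.lookup c g * Poly_Mapping.lookup (Poly_Mapping.single g 1) k)
      = (\<Sum>g\<in>Poly_Mapping.keys c. if g = k then Poly_Mapping.lookup c g else 0)"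
    by (rule sum.cong) (auto simp: lookup_single when_def)
  also have "\<dots> = Poly_Mapping.lookup c k"
    by (simp add: in_keys_iff)
  finally show "Poly_Mapping.lookup c k = Poly_Mapping.lookup (\<Sum>g \<in> Poly_Mapping.keys c.
      scale (Poly_Mapping.lookup c g) (Poly_Mapping.single g 1)) k"
    by (simp add: lookup_sum)
qed

lemma linear_extension_superset:
  assumes "finite S" and "Poly_Mapping.keys c \<subseteq> S"
  shows "linear_extension f c = (\<Sum>g \<in> S. scale (Poly_Mapping.lookup c g) (f g))"
  unfolding linear_extension_def using assms
  by (intro sum.mono_neutral_left) (auto simp: in_keys_iff)

text \<open>
  A sum over the support of \<open>c\<close> may be taken over any finite set containing the support, so two chains
  can be expanded over a common index set.
\<close>
lemma linear_linear_extension: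
  fixes f :: "'g \<Rightarrow> ('h \<Rightarrow>\<^sub>0 'k::field)"
  shows "chain_linear (linear_extension f)"
  unfolding Vector_Spaces.linear_iff
proof (intro conjI allI chain.vector_space_axioms)
  fix c d :: "'g \<Rightarrow>\<^sub>0 'k" and a :: 'k
  let ?S = "Poly_Mapping.keys c \<union> Poly_Mapping.keys d"
  have "Poly_Mapping.keys (c + d) \<subseteq> ?S" by (rule keys_add)
  then show "linear_extension f (c + d) = linear_extension f c + linear_extension f d"
    by (subst (1 2 3) linear_extension_superset[where S = ?S])
      (auto simp: lookup_add chain.scale_left_distrib sum.distrib)
  have "Poly_Mapping.keys (scale a c) \<subseteq> Poly_Mapping.keys c"
    by (auto simp: in_keys_iff)
  then show "linear_extension f (scale a c) = scale a (linear_extension f c)"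
    by (subst (1 2) linear_extension_superset[where S = "Poly_Mapping.keys c"])
      (auto simp: chain.scale_sum_right)
qed

lemma linear_extension_single [simp]: "linear_extension f (Poly_Mapping.single g a) = scale a (f g)"
  by (simp add: linear_extension_def)

lemma linear_extension_mem:
  assumes "chain.subspace T" and "\<And>g. g \<in> S \<Longrightarrow> f g \<in> T" and "c \<in> chains_on S"
  shows "linear_extension f c \<in> T"
  unfolding linear_extension_def using assms
  by (intro chain.subspace_sum chain.subspace_scale) (auto simp: chains_on_def)

text \<open>
  Every identity of chain maps below reduces by this lemma to a computation on single generators.
\<close>
lemma chain_linear_eq_on_generators:
  assumes "chain_linear f" "chain_linear h"
    and "\<And>g. g \<in> S \<Longrightarrow> f (Poly_Mapping.single g 1) = h (Poly_Mapping.single g 1)"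
    and "c \<in> chains_on S"
  shows "f c = h c"
proof -
  have "f c = (\<Sum>g \<in> Poly_Mapping.keys c. scale (Poly_Mapping.lookup c g) (f (Poly_Mapping.single g 1)))"
    by (subst chain_expansion) (simp add: chain.linear_sum[OF assms(1)] chain.linear_scale[OF assms(1)])
  also have "\<dots> = (\<Sum>g \<in> Poly_Mapping.keys c. scale (Poly_Mapping.lookup c g) (h (Poly_Mapping.single g 1)))"
    using assms(3,4) by (intro sum.cong) (auto simp: chains_on_def)
  also have "\<dots> = h c"
    by (subst (3) chain_expansion) (simp add: chain.linear_sum[OF assms(2)] chain.linear_scale[OF assms(2)])
  finally show ?thesis .
qed

lemma scale_single [simp]: "scale a (Poly_Mapping.single g b) = Poly_Mapping.single g (a * b)"
  by (simp add: scale_def)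

text \<open>
  The terms cancel in pairs. The diagonal has to be left out, since in characteristic 2 antisymmetry
  does not make it vanish.
\<close>
lemma antisymmetric_double_sum:
  fixes F :: "'a \<Rightarrow> 'a \<Rightarrow> 'b::ab_group_add"
  assumes "finite A" and "\<And>v w. v \<in> A \<Longrightarrow> w \<in> A \<Longrightarrow> v \<noteq> w \<Longrightarrow> F v w + F w v = 0"
  shows "(\<Sum>v\<in>A. \<Sum>w\<in>A - {v}. F v w) = 0"
  using assms
proof (induction A rule: finite_induct)
  case (insert a A)
  have "(\<Sum>v\<in>A. \<Sum>w\<in>insert a A - {v}. F v w) = (\<Sum>v\<in>A. F v a + (\<Sum>w\<in>A - {v}. F v w))"
  proof (rule sum.cong)
    fix v assume "v \<in> A"
    then have "insert a A - {v} = insert a (A - {v})" "a \<notin> A - {v}" using insert.hyps by auto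
    then show "(\<Sum>w\<in>insert a A - {v}. F v w) = F v a + (\<Sum>w\<in>A - {v}. F v w)"
      using insert.hyps by (simp add: sum.insert)
  qed simp
  moreover have "insert a A - {a} = A" using insert.hyps by auto
  ultimately have "(\<Sum>v\<in>insert a A. \<Sum>w\<in>insert a A - {v}. F v w)
      = (\<Sum>w\<in>A. F a w + F w a) + (\<Sum>v\<in>A. \<Sum>w\<in>A - {v}. F v w)"
    using insert.hyps by (simp add: sum.distrib add.assoc)
  also have "(\<Sum>w\<in>A. F a w + F w a) = 0"
    using insert.hyps insert.prems by (intro sum.neutral) auto
  finally show ?case using insert by simp
qed simp

section \<open>Quotients and homology\<close>

text \<open>
  Elements of a quotient are cosets, so the induced map is the image under \<open>\<phi>\<close>: since
  \<open>\<phi> ` B = B'\<close>, it takes full cosets of \<open>B\<close> to full cosets of \<open>B'\<close>. The last hypothesis is injectivity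
  of the induced map.
\<close>
lemma linear_iso_quotient_space:
  fixes \<phi> :: "('g \<Rightarrow>\<^sub>0 'k::field) \<Rightarrow> ('h \<Rightarrow>\<^sub>0 'k)"
  assumes lin: "chain_linear \<phi>"
    and Z: "chain.subspace Z" and B: "chain.subspace B"
    and Z': "\<phi> ` Z = Z'" and B': "\<phi> ` B = B'"
    and kernel: "\<And>z. z \<in> Z \<Longrightarrow> \<phi> z \<in> B' \<Longrightarrow> z \<in> B"
  shows "linear_iso (quotient_space Z B) (quotient_space Z' B') ((`) \<phi>)"
proof -
  let ?R = "{(z, z'). z \<in> Z \<and> z' \<in> Z \<and> z - z' \<in> B}"
  let ?R' = "{(z, z'). z \<in> Z' \<and> z' \<in> Z' \<and> z - z' \<in> B'}"
  have diff: "\<phi> (x - y) = \<phi> x - \<phi> y" for x y by (rule chain.linear_diff[OF lin])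
  have add: "\<phi> (x + y) = \<phi> x + \<phi> y" for x y by (rule chain.linear_add[OF lin])
  have sc: "\<phi> (scale a x) = scale a (\<phi> x)" for a x by (rule chain.linear_scale[OF lin])
  have iff: "\<phi> z - \<phi> z' \<in> B' \<longleftrightarrow> z - z' \<in> B" if "z \<in> Z" "z' \<in> Z" for z z'
  proof
    assume "\<phi> z - \<phi> z' \<in> B'"
    then show "z - z' \<in> B" using kernel chain.subspace_diff[OF Z that] by (simp add: diff)
  next
    assume "z - z' \<in> B"
    then show "\<phi> z - \<phi> z' \<in> B'" using B' diff by (metis imageI)
  qed
  have coset: "\<phi> ` (?R `` {z}) = ?R' `` {\<phi> z}" if "z \<in> Z" for z
    using that Z' iff by (auto simp: image_iff)
  have "bij_betw ((`) \<phi>) (Z // ?R) (Z' // ?R')"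
  proof (rule bij_betw_imageI)
    show "inj_on ((`) \<phi>) (Z // ?R)"
    proof (rule inj_onI)
      fix X Y assume "X \<in> Z // ?R" "Y \<in> Z // ?R" and eq: "\<phi> ` X = \<phi> ` Y"
      then obtain x y where x: "x \<in> Z" "X = ?R `` {x}" and y: "y \<in> Z" "Y = ?R `` {y}"
        by (auto elim!: quotientE)
      have "\<phi> y \<in> ?R' `` {\<phi> y}"
        using y Z' B' chain.subspace_0[OF B] chain.linear_0[OF lin] by force
      then have "\<phi> y \<in> ?R' `` {\<phi> x}"
        using eq coset[OF x(1)] coset[OF y(1)] x y by simp
      then have xy: "x - y \<in> B" using x y iff by auto
      have "x - w \<in> B \<longleftrightarrow> y - w \<in> B" for w
        using chain.subspace_diff[OF B, of "x - w" "x - y"] chain.subspace_add[OF B, of "y - w" "x - y"] xy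
        by auto
      then show "X = Y" using x y by auto
    qed
    show "(`) ((`) \<phi>) (Z // ?R) = Z' // ?R'"
    proof -
      have classes: "A // R = (\<lambda>z. R `` {z}) ` A" for A :: "'c set" and R
        by (auto simp: quotient_def)
      show ?thesis unfolding classes Z'[symmetric] image_image
        using coset unfolding Z' by (rule image_cong[OF refl])
    qed
  qed
  moreover have "\<phi> ` {x + y | x y. x \<in> X \<and> y \<in> Y} = {x + y | x y. x \<in> \<phi> ` X \<and> y \<in> \<phi> ` Y}" for X Y
  proof -
    have "\<phi> (x + y) \<in> \<phi> ` {x + y | x y. x \<in> X \<and> y \<in> Y}" if "x \<in> X" "y \<in> Y" for x y
      using that by (intro imageI) blast
    then show ?thesis by (auto simp: add) blast
  qed
  moreover have "\<phi> ` {scale a x + b | x b. x \<in> X \<and> b \<in> B}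
      = {scale a x + b | x b. x \<in> \<phi> ` X \<and> b \<in> B'}" for a X
  proof -
    have "\<phi> (scale a x + b) \<in> \<phi> ` {scale a x + b | x b. x \<in> X \<and> b \<in> B}" if "x \<in> X" "b \<in> B" for x b
      using that by (intro imageI) blast
    then show ?thesis unfolding B'[symmetric] by (auto simp: add sc) blast
  qed
  ultimately show ?thesis
    by (simp add: linear_iso_def quotient_space_def)
qed

text \<open>
  A surjective chain map with acyclic kernel is a quasi-isomorphism. The two steps of the long exact
  sequence that are needed are done by hand: any lift of a cycle is corrected by a chain of the kernel
  to become a cycle, and a cycle that becomes a boundary \<open>D' (\<phi> b)\<close> differs from the boundary \<open>D b\<close>
  by a cycle of the kernel. Acyclicity in degree 0 is a separate hypothesis, because there no chains
  of lower degree exist.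
\<close>
lemma linear_iso_homology:
  fixes C :: "nat \<Rightarrow> ('g \<Rightarrow>\<^sub>0 'k::field) set" and C' :: "nat \<Rightarrow> ('h \<Rightarrow>\<^sub>0 'k) set"
    and D :: "('g \<Rightarrow>\<^sub>0 'k) \<Rightarrow> ('g \<Rightarrow>\<^sub>0 'k)" and D' :: "('h \<Rightarrow>\<^sub>0 'k) \<Rightarrow> ('h \<Rightarrow>\<^sub>0 'k)"
  assumes lin: "chain_linear D" "chain_linear D'" "chain_linear \<phi>"
    and C: "\<And>i. chain.subspace (C i)"
    and D: "\<And>i c. c \<in> C i \<Longrightarrow> D c \<in> C (Suc i)"
    and DD: "\<And>i c. c \<in> C i \<Longrightarrow> D (D c) = 0"
    and surj: "\<And>i. \<phi> ` C i = C' i"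
    and chain_map: "\<And>i c. c \<in> C i \<Longrightarrow> \<phi> (D c) = D' (\<phi> c)"
    and acyclic0: "\<And>c. c \<in> C 0 \<Longrightarrow> \<phi> c = 0 \<Longrightarrow> D c = 0 \<Longrightarrow> c = 0"
    and acyclic: "\<And>i c. c \<in> C (Suc i) \<Longrightarrow> \<phi> c = 0 \<Longrightarrow> D c = 0 \<Longrightarrow> \<exists>k \<in> C i. \<phi> k = 0 \<and> D k = c"
  shows "linear_iso
    (quotient_space {c \<in> C i. D c = 0} (case i of 0 \<Rightarrow> {0} | Suc j \<Rightarrow> D ` C j))
    (quotient_space {c \<in> C' i. D' c = 0} (case i of 0 \<Rightarrow> {0} | Suc j \<Rightarrow> D' ` C' j))
    ((`) \<phi>)"
proof (rule linear_iso_quotient_space[OF lin(3)])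
  have zero: "\<phi> 0 = 0" "D' 0 = 0" "D 0 = 0"
    using lin by (auto intro: chain.linear_0)
  have diff: "\<phi> (x - y) = \<phi> x - \<phi> y" "D (x - y) = D x - D y" for x y
    using lin by (auto intro: chain.linear_diff)
  show "chain.subspace {c \<in> C i. D c = 0}"
    using chain.subspace_inter[OF C[of i] chain.linear_subspace_kernel[OF lin(1)]]
    by (simp add: Int_def)
  show "chain.subspace (case i of 0 \<Rightarrow> {0} | Suc j \<Rightarrow> D ` C j)"
    using chain.linear_subspace_image[OF lin(1) C] by (cases i) simp_all
  have lift: "z \<in> \<phi> ` {c \<in> C i. D c = 0}" if z: "z \<in> C' i" "D' z = 0" for z
  proof -
    from z(1) obtain c where c: "c \<in> C i" "\<phi> c = z" unfolding surj[symmetric] by auto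
    \<comment> \<open>The defect of the lift, \<open>D c\<close>, is a cycle of the kernel and hence bounds a chain \<open>k\<close> of the kernel.\<close>
    have "\<phi> (D c) = 0" using chain_map[OF c(1)] c z by simp
    then obtain k where "k \<in> C i" "\<phi> k = 0" "D k = D c"
      using acyclic[OF D[OF c(1)]] DD[OF c(1)] by auto
    then show ?thesis
      using c chain.subspace_diff[OF C] by (intro image_eqI[of _ _ "c - k"]) (auto simp: diff)
  qed
  have "\<phi> c \<in> C' i \<and> D' (\<phi> c) = 0" if "c \<in> C i" "D c = 0" for c
    using that surj[of i] chain_map[OF that(1)] by (auto simp: zero)
  with lift show "\<phi> ` {c \<in> C i. D c = 0} = {c \<in> C' i. D' c = 0}"
    by blast
  show "\<phi> ` (case i of 0 \<Rightarrow> {0} | Suc j \<Rightarrow> D ` C j) = (case i of 0 \<Rightarrow> {0} | Suc j \<Rightarrow> D' ` C' j)"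
  proof (cases i)
    case (Suc j)
    have "\<phi> ` D ` C j = (\<lambda>c. D' (\<phi> c)) ` C j"
      unfolding image_image using chain_map by (rule image_cong[OF refl])
    then show ?thesis using Suc surj[of j] by (simp flip: image_image)
  qed (simp add: zero)
  show "z \<in> (case i of 0 \<Rightarrow> {0} | Suc j \<Rightarrow> D ` C j)"
    if z: "z \<in> {c \<in> C i. D c = 0}" and bd: "\<phi> z \<in> (case i of 0 \<Rightarrow> {0} | Suc j \<Rightarrow> D' ` C' j)" for z
  proof (cases i)
    case 0
    then show ?thesis using z bd acyclic0 by simp
  next
    case (Suc j)
    then obtain b where b: "b \<in> C j" "\<phi> z = D' (\<phi> b)"
      using bd unfolding Suc nat.case surj[symmetric] by blast
    have "z - D b \<in> C (Suc j)" using z D[OF b(1)] Suc chain.subspace_diff[OF C] by auto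
    moreover have "\<phi> (z - D b) = 0" "D (z - D b) = 0"
      using z b chain_map[OF b(1)] DD[OF b(1)] by (auto simp: diff)
    ultimately obtain k where "k \<in> C j" "D k = z - D b" using acyclic by blast
    then have "z = D (k + b)" "k + b \<in> C j"
      using b chain.subspace_add[OF C] by (auto simp: chain.linear_add[OF lin(1)])
    then show ?thesis using Suc by auto
  qed
qed

section \<open>Connected components\<close>

lemma (in sym_digraph) connected_imp_reachable:
  assumes "subgraph C G" and "connected C" and "u \<in> verts C" and "v \<in> verts C"
  shows "u \<rightarrow>\<^sup>* v"
proof -
  have "u \<rightarrow>\<^sup>*\<^bsub>mk_symmetric C\<^esub> v"
    using assms by (auto simp: connected_def strongly_connected_def)
  then have "u \<rightarrow>\<^sup>*\<^bsub>mk_symmetric G\<^esub> v"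
    by (rule pre_digraph.reachable_mono[OF _ subgraph_mk_symmetric[OF assms(1)]])
  then show ?thesis using reachable_mk_symmetric_eq[OF sym_arcs] by simp
qed

lemma (in sym_digraph) connected_reachability_class:
  assumes "u \<in> verts G"
  shows "connected (G \<restriction> {v. u \<rightarrow>\<^sup>* v})"
proof -
  interpret C: wf_digraph "G \<restriction> {v. u \<rightarrow>\<^sup>* v}" by (rule wellformed_induce_subgraph)
  have "strongly_connected (G \<restriction> {v. u \<rightarrow>\<^sup>* v})"
    using induce_reachable_is_in_sccs[OF assms] by (auto elim: in_sccsE)
  then show ?thesis
    unfolding connected_def strongly_connected_def using C.reachable_mk_symmetricI by simp
qed

text \<open>
  A component is by definition the vertex set of a maximal connected subgraph. In a symmetric digraph
  any connected subgraph through \<open>u\<close> lies inside the subgraph induced by the vertices reachable from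
  \<open>u\<close>, and that induced subgraph is itself connected; so these are exactly the maximal ones.
\<close>
lemma (in sym_digraph) components_eq_reachability_classes:
  "components G = (\<lambda>u. {v. u \<rightarrow>\<^sup>* v}) ` verts G"
proof -
  have class_subgraph: "subgraph (G \<restriction> {v. u \<rightarrow>\<^sup>* v}) G" for u
    by (rule subgraph_induce_subgraphI) (auto elim: reachable_in_vertsE)
  have sub: "subgraph C (G \<restriction> {v. u \<rightarrow>\<^sup>* v})" if "subgraph C G" "connected C" "u \<in> verts C" for C u
  proof -
    interpret C: wf_digraph C using that(1) by auto
    have "verts C \<subseteq> {v. u \<rightarrow>\<^sup>* v}" using connected_imp_reachable that by blast
    then show ?thesis
      using that(1) C.wellformed wellformed_induce_subgraph
      by (auto simp: subgraph_def compatible_def subset_iff)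
  qed
  show ?thesis
  proof (intro equalityI subsetI)
    fix x assume "x \<in> components G"
    then obtain C where C: "max_subgraph connected C" "x = verts C"
      by (auto simp: components_def)
    then have sC: "subgraph C G" "connected C" by (auto simp: max_subgraph_def)
    then obtain u where u: "u \<in> verts C" by (auto simp: connected_def strongly_connected_def)
    then have uG: "u \<in> verts G" using sC(1) by auto
    have "C = G \<restriction> {v. u \<rightarrow>\<^sup>* v}"
    proof (rule ccontr)
      assume "C \<noteq> G \<restriction> {v. u \<rightarrow>\<^sup>* v}"
      with C(1) sub[OF sC u] have "\<not> (subgraph (G \<restriction> {v. u \<rightarrow>\<^sup>* v}) G \<and> connected (G \<restriction> {v. u \<rightarrow>\<^sup>* v}))"
        unfolding max_subgraph_def by metis
      with class_subgraph connected_reachability_class[OF uG] show False by metis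
    qed
    then show "x \<in> (\<lambda>u. {v. u \<rightarrow>\<^sup>* v}) ` verts G" using C uG by auto
  next
    fix x assume "x \<in> (\<lambda>u. {v. u \<rightarrow>\<^sup>* v}) ` verts G"
    then obtain u where u: "u \<in> verts G" "x = {v. u \<rightarrow>\<^sup>* v}" by auto
    have "H = G \<restriction> {v. u \<rightarrow>\<^sup>* v}"
      if "subgraph (G \<restriction> {v. u \<rightarrow>\<^sup>* v}) H" "subgraph H G" "connected H" for H
    proof -
      have "u \<in> verts H" using subgraph_imp_subverts[OF that(1)] u by auto
      from sub[OF that(2,3) this] that(1) show ?thesis
        unfolding subgraph_def compatible_def by (intro pre_digraph.equality) auto
    qed
    then have "max_subgraph connected (G \<restriction> {v. u \<rightarrow>\<^sup>* v})"
      unfolding max_subgraph_def using class_subgraph connected_reachability_class[OF u(1)] by blast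
    then show "x \<in> components G"
      unfolding components_def by (intro image_eqI[of _ _ "G \<restriction> {v. u \<rightarrow>\<^sup>* v}"]) (simp_all add: u(2))
  qed
qed

lemma (in sym_digraph) components_overlap_eq:
  assumes "x \<in> components G" "y \<in> components G" "u \<in> x" "u \<in> y"
  shows "x = y"
proof -
  have "z = {v. u \<rightarrow>\<^sup>* v}" if z: "z \<in> components G" "u \<in> z" for z
  proof -
    from z obtain a where a: "z = {v. a \<rightarrow>\<^sup>* v}" "a \<rightarrow>\<^sup>* u"
      unfolding components_eq_reachability_classes by auto
    then show ?thesis using reachable_trans[OF a(2)] reachable_trans[OF symmetric_reachable'[OF a(2)]]
      by blast
  qed
  with assms show ?thesis by metis
qed

lemma (in sym_digraph) component_nonempty: "x \<in> components G \<Longrightarrow> x \<noteq> {}"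
  unfolding components_eq_reachability_classes by auto

text \<open>
  This is what makes the differential well defined: enlarging a graph sends each component into a
  unique component.
\<close>
lemma (in sym_digraph) ex1_component_superset:
  assumes "subgraph H G" and "sym_digraph H" and x: "x \<in> components H"
  shows "\<exists>!y. y \<in> components G \<and> x \<subseteq> y"
proof -
  interpret H: sym_digraph H by fact
  from x obtain u where u: "u \<in> verts H" "x = {v. u \<rightarrow>\<^sup>*\<^bsub>H\<^esub> v}"
    unfolding H.components_eq_reachability_classes by auto
  have "x \<subseteq> {v. u \<rightarrow>\<^sup>* v}" "u \<in> verts G" using u assms(1) reachable_mono by auto
  then have "\<exists>y. y \<in> components G \<and> x \<subseteq> y"
    unfolding components_eq_reachability_classes by blast
  moreover have "y = y'" if "y \<in> components G" "x \<subseteq> y" "y' \<in> components G" "x \<subseteq> y'" for y y'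
    using that components_overlap_eq H.component_nonempty[OF x] by blast
  ultimately show ?thesis by blast
qed

lemma (in sym_digraph) components_dominated:
  assumes a: "a \<in> verts G" and dom: "\<And>v. v \<in> verts G \<Longrightarrow> v \<noteq> a \<Longrightarrow> (a, v) \<in> arcs_ends G"
  shows "components G = {verts G}"
proof -
  have "a \<rightarrow>\<^sup>* v" if "v \<in> verts G" for v using dom[OF that] a by (cases "v = a") auto
  then have "u \<rightarrow>\<^sup>* v" if "u \<in> verts G" "v \<in> verts G" for u v
    using that symmetric_reachable' reachable_trans by metis
  then have "{v. u \<rightarrow>\<^sup>* v} = verts G" if "u \<in> verts G" for u
    using that reachable_in_verts(2) by blast
  then show ?thesis unfolding components_eq_reachability_classes using a by auto
qed

lemma components_embedding:
  assumes "sym_digraph G" "sym_digraph H"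
    and verts: "verts H = f ` verts G"
    and arcs: "arcs_ends H = (\<lambda>(u, v). (f u, f v)) ` arcs_ends G"
    and inj: "inj_on f (verts G)"
  shows "components H = (`) f ` components G"
proof -
  interpret G: sym_digraph G by fact
  interpret H: sym_digraph H by fact
  have mapped: "f u \<rightarrow>\<^sup>*\<^bsub>H\<^esub> f v" if "u \<rightarrow>\<^sup>*\<^bsub>G\<^esub> v" for u v
    using that
  proof (induction rule: G.converse_reachable_induct)
    case base
    then show ?case using verts by auto
  next
    case (step u w)
    then have "f u \<rightarrow>\<^bsub>H\<^esub> f w" unfolding arcs by (intro image_eqI[of _ _ "(u, w)"]) simp_all
    then show ?case using step.IH by (rule H.adj_reachable_trans)
  qed
  have lifted: "w \<in> f ` {v. u \<rightarrow>\<^sup>*\<^bsub>G\<^esub> v}" if "f u \<rightarrow>\<^sup>*\<^bsub>H\<^esub> w" "u \<in> verts G" for u w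
    using that
  proof (induction rule: H.reachable_induct)
    case base
    then show ?case by auto
  next
    case (step w z)
    from step.IH[OF step.prems] obtain v where v: "w = f v" "u \<rightarrow>\<^sup>*\<^bsub>G\<^esub> v" by blast
    from step.hyps(2) obtain v' z' where z: "w = f v'" "z = f z'" "v' \<rightarrow>\<^bsub>G\<^esub> z'"
      unfolding arcs by auto
    have "v' = v" using inj v z G.reachable_in_verts(2)[OF v(2)] G.adj_in_verts(1)[OF z(3)]
      by (metis inj_onD)
    then show ?case using v z G.reachable_adj_trans[of u v z'] by auto
  qed
  have "{w. f u \<rightarrow>\<^sup>*\<^bsub>H\<^esub> w} = f ` {v. u \<rightarrow>\<^sup>*\<^bsub>G\<^esub> v}" if "u \<in> verts G" for u
    using mapped lifted[OF _ that] by (intro equalityI subsetI) auto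
  then show ?thesis
    unfolding G.components_eq_reachability_classes H.components_eq_reachability_classes verts image_image
    by (rule image_cong[OF refl])
qed

section \<open>Coloured subgraphs\<close>

lemma verts_coloured_subgraph [simp]:
  "verts (coloured_subgraph G \<epsilon>) = {v \<in> pverts G. \<epsilon> v = 1}"
  by (simp add: coloured_subgraph_def)

lemma arcs_ends_coloured_subgraph:
  "arcs_ends (coloured_subgraph G \<epsilon>) =
     {(u, v) \<in> parcs G. u \<in> pverts G \<and> \<epsilon> u = 1 \<and> v \<in> pverts G \<and> \<epsilon> v = 1}"
  by (auto simp: coloured_subgraph_def arcs_ends_conv)

lemma sym_digraph_coloured_subgraph:
  assumes "pair_graph G"
  shows "sym_digraph (coloured_subgraph G \<epsilon>)"
proof -
  interpret pair_graph G by fact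
  show ?thesis unfolding coloured_subgraph_def
    by (rule induced_graph_imp_graph) (auto intro: induced_induce)
qed

lemma subgraph_coloured_subgraph_mono:
  assumes "pair_graph G" and "\<And>v. v \<in> pverts G \<Longrightarrow> \<epsilon> v = 1 \<Longrightarrow> \<epsilon>' v = 1"
  shows "subgraph (coloured_subgraph G \<epsilon>) (coloured_subgraph G \<epsilon>')"
proof -
  interpret pair_graph G by fact
  show ?thesis unfolding coloured_subgraph_def subgraph_def compatible_def
    using assms(2) wellformed_induce_subgraph by auto
qed

section \<open>The bold complex\<close>

(* Colours are the numerals 0 and 1; rewriting 1 to Suc 0 would hide the updates \<epsilon>(v := 1). *)
declare One_nat_def [simp del]

definition bit_sign :: "bit \<Rightarrow> 'k::field" where
  "bit_sign b = (if b = 0 then 1 else - 1)"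

lemma bit_sign_add: "bit_sign (a + b) = bit_sign a * bit_sign b"
  by (cases a; cases b) (simp_all add: bit_sign_def)

lemma bit_sign_square [simp]: "bit_sign a * bit_sign a = 1"
  by (simp add: bit_sign_def)

lemma bit_sign_opposite: "a + b = 1 \<Longrightarrow> bit_sign a + bit_sign b = 0"
  by (cases a; cases b) (simp_all add: bit_sign_def)

text \<open>
  The component of \<open>coloured_subgraph G \<epsilon>\<close> that absorbs \<open>x\<close>. It is meaningful when \<open>x\<close> is a component
  for a smaller colouring, where existence and uniqueness hold.
\<close>
definition merge :: "'a pair_pre_digraph \<Rightarrow> ('a \<Rightarrow> nat) \<Rightarrow> 'a set \<Rightarrow> 'a set" where
  "merge G \<epsilon> x = (THE y. y \<in> components (coloured_subgraph G \<epsilon>) \<and> x \<subseteq> y)"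

lemma merge_unique_existence:
  assumes "pair_graph G" and "\<And>v. \<epsilon> v = 1 \<Longrightarrow> \<epsilon>' v = 1"
    and "x \<in> components (coloured_subgraph G \<epsilon>)"
  shows "\<exists>!y. y \<in> components (coloured_subgraph G \<epsilon>') \<and> x \<subseteq> y"
proof -
  interpret sym_digraph "coloured_subgraph G \<epsilon>'"
    using assms(1) by (rule sym_digraph_coloured_subgraph)
  show ?thesis
    using assms by (intro ex1_component_superset[of "coloured_subgraph G \<epsilon>"]
        subgraph_coloured_subgraph_mono sym_digraph_coloured_subgraph) auto
qed

lemma merge_component:
  assumes "pair_graph G" and "\<And>v. \<epsilon> v = 1 \<Longrightarrow> \<epsilon>' v = 1"
    and "x \<in> components (coloured_subgraph G \<epsilon>)"
  shows "merge G \<epsilon>' x \<in> components (coloured_subgraph G \<epsilon>')" and "x \<subseteq> merge G \<epsilon>' x"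
  using theI'[OF merge_unique_existence[of G \<epsilon> \<epsilon>' x]] assms unfolding merge_def by blast+

lemma merge_eqI:
  assumes "pair_graph G" and "\<And>v. \<epsilon> v = 1 \<Longrightarrow> \<epsilon>' v = 1"
    and "x \<in> components (coloured_subgraph G \<epsilon>)"
    and "y \<in> components (coloured_subgraph G \<epsilon>')" and "x \<subseteq> y"
  shows "merge G \<epsilon>' x = y"
  unfolding merge_def
  using merge_unique_existence[of G \<epsilon> \<epsilon>' x] assms by (intro the1_equality) auto

lemma bold_chains_eq: "bold_chains G i = chains_on (generators G i)"
  by (simp add: bold_chains_def chains_on_def)

lemma bold_diff_eq: "bold_diff G s = linear_extension (bold_diff_gen G s)"
  by (simp add: fun_eq_iff bold_diff_def linear_extension_def)

lemma generators_iff: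
  "(\<epsilon>, x) \<in> generators G i \<longleftrightarrow>
     \<epsilon> \<in> bicolourings G \<and> (\<Sum>v \<in> pverts G. \<epsilon> v) = i \<and> x \<in> components (coloured_subgraph G \<epsilon>)"
  by (simp add: generators_def)

lemma bicolouring_cases:
  assumes "\<epsilon> \<in> bicolourings G" and "v \<in> pverts G"
  obtains "\<epsilon> v = 0" | "\<epsilon> v = 1"
  using PiE_mem[OF assms[unfolded bicolourings_def]] by auto

lemma bicolouring_upd:
  assumes "\<epsilon> \<in> bicolourings G" and "v \<in> pverts G" and "a \<in> {0, 1}"
  shows "\<epsilon>(v := a) \<in> bicolourings G"
  using assms unfolding bicolourings_def by (auto simp: PiE_iff extensional_def)

lemma finite_pverts: "pair_graph G \<Longrightarrow> finite (pverts G)"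
  by (rule pair_fin_digraph.pair_finite_verts) (simp add: pair_graph_def pair_digraph_def)

lemma sum_colour_upd:
  fixes \<epsilon> :: "'a \<Rightarrow> nat"
  assumes "finite V" and "v \<in> V" and "\<epsilon> v = 0"
  shows "(\<Sum>w\<in>V. (\<epsilon>(v := 1)) w) = Suc (\<Sum>w\<in>V. \<epsilon> w)"
proof -
  have "(\<Sum>w\<in>V. (\<epsilon>(v := 1)) w) = 1 + (\<Sum>w\<in>V - {v}. (\<epsilon>(v := 1)) w)"
    using assms by (subst sum.remove[of V v]) auto
  also have "(\<Sum>w\<in>V - {v}. (\<epsilon>(v := 1)) w) = (\<Sum>w\<in>V - {v}. \<epsilon> w)"
    by (rule sum.cong) auto
  also have "\<dots> = (\<Sum>w\<in>V. \<epsilon> w)" using assms by (simp add: sum.remove[of V v])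
  finally show ?thesis by simp
qed

text \<open>
  The pairs \<open>(\<epsilon>', y)\<close> occurring in the differential are determined by the flipped vertex, which turns
  the differential into a sum over the vertices of colour 0.
\<close>
lemma bold_diff_gen_eq:
  assumes G: "pair_graph G" and \<epsilon>: "\<epsilon> \<in> bicolourings G"
    and x: "x \<in> components (coloured_subgraph G \<epsilon>)"
  shows "bold_diff_gen G s (\<epsilon>, x) = (\<Sum>v \<in> {v \<in> pverts G. \<epsilon> v = 0}.
    Poly_Mapping.single (\<epsilon>(v := 1), merge G (\<epsilon>(v := 1)) x) (bit_sign (s \<epsilon> (\<epsilon>(v := 1)))))"
proof -
  let ?m = "\<lambda>v. (\<epsilon>(v := 1), merge G (\<epsilon>(v := 1)) x)"
  let ?Z = "{v \<in> pverts G. \<epsilon> v = 0}"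
  have "{(\<epsilon>', y). flips G \<epsilon> \<epsilon>' \<and> y \<in> components (coloured_subgraph G \<epsilon>') \<and> x \<subseteq> y} = ?m ` ?Z"
  proof (intro equalityI subsetI)
    fix g assume "g \<in> {(\<epsilon>', y). flips G \<epsilon> \<epsilon>' \<and> y \<in> components (coloured_subgraph G \<epsilon>') \<and> x \<subseteq> y}"
    then obtain v y where v: "v \<in> ?Z" "g = (\<epsilon>(v := 1), y)"
      "y \<in> components (coloured_subgraph G (\<epsilon>(v := 1)))" "x \<subseteq> y"
      by (auto simp: flips_def)
    have "merge G (\<epsilon>(v := 1)) x = y" by (rule merge_eqI[OF G _ x]) (use v in auto)
    then show "g \<in> ?m ` ?Z" using v by auto
  next
    fix g assume "g \<in> ?m ` ?Z"
    then obtain v where v: "v \<in> ?Z" "g = ?m v" by auto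
    have "merge G (\<epsilon>(v := 1)) x \<in> components (coloured_subgraph G (\<epsilon>(v := 1)))"
      "x \<subseteq> merge G (\<epsilon>(v := 1)) x"
      by (rule merge_component[OF G _ x]; simp)+
    then show "g \<in> {(\<epsilon>', y). flips G \<epsilon> \<epsilon>' \<and> y \<in> components (coloured_subgraph G \<epsilon>') \<and> x \<subseteq> y}"
      using v \<epsilon> by (auto simp: flips_def)
  qed
  moreover have "inj_on ?m ?Z"
  proof (rule inj_onI)
    fix v w assume "v \<in> ?Z" "w \<in> ?Z" "?m v = ?m w"
    then have "(\<epsilon>(v := 1)) v = (\<epsilon>(w := 1)) v" "\<epsilon> v = 0" by auto
    then show "v = w" by (auto split: if_splits)
  qed
  ultimately show ?thesis
    unfolding bold_diff_gen_def by (simp add: sum.reindex bit_sign_def)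
qed

lemma coloured_generator:
  assumes G: "pair_graph G" and g: "(\<epsilon>, x) \<in> generators G i" and v: "v \<in> pverts G" "\<epsilon> v = 0"
  shows "(\<epsilon>(v := 1), merge G (\<epsilon>(v := 1)) x) \<in> generators G (Suc i)"
proof -
  have "merge G (\<epsilon>(v := 1)) x \<in> components (coloured_subgraph G (\<epsilon>(v := 1)))"
    using g by (intro merge_component(1)[OF G, of \<epsilon>]) (auto simp: generators_iff)
  moreover have "\<epsilon>(v := 1) \<in> bicolourings G"
    by (rule bicolouring_upd) (use g v in \<open>auto simp: generators_iff\<close>)
  moreover have "(\<Sum>w\<in>pverts G. (\<epsilon>(v := 1)) w) = Suc i"
    using sum_colour_upd[where \<epsilon> = \<epsilon>, OF finite_pverts[OF G] v] g by (simp only: generators_iff)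
  ultimately show ?thesis by (simp only: generators_iff simp_thms)
qed

lemma bold_diff_chain:
  fixes c :: "'a generator \<Rightarrow>\<^sub>0 'k::field"
  assumes G: "pair_graph G" and c: "c \<in> bold_chains G i"
  shows "bold_diff G s c \<in> bold_chains G (Suc i)"
  unfolding bold_diff_eq bold_chains_eq
proof (rule linear_extension_mem[OF subspace_chains_on _ c[unfolded bold_chains_eq]])
  fix g assume g: "g \<in> generators G i"
  obtain \<epsilon> x where [simp]: "g = (\<epsilon>, x)" by (cases g)
  have "bold_diff_gen G s g = (\<Sum>v \<in> {v \<in> pverts G. \<epsilon> v = 0}.
    Poly_Mapping.single (\<epsilon>(v := 1), merge G (\<epsilon>(v := 1)) x) (bit_sign (s \<epsilon> (\<epsilon>(v := 1))) :: 'k))"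
    unfolding \<open>g = _\<close> by (rule bold_diff_gen_eq[OF G]) (use g in \<open>auto simp: generators_iff\<close>)
  also have "\<dots> \<in> chains_on (generators G (Suc i))"
    using g coloured_generator[OF G]
    by (intro chain.subspace_sum[OF subspace_chains_on] single_in_chains_on) simp
  finally show "(bold_diff_gen G s g :: _ \<Rightarrow>\<^sub>0 'k) \<in> chains_on (generators G (Suc i))" .
qed

lemma sign_assignmentD:
  assumes "sign_assignment G s" and "\<epsilon> \<in> bicolourings G"
    and "v \<in> pverts G" "w \<in> pverts G" "\<epsilon> v = 0" "\<epsilon> w = 0" "v \<noteq> w"
  shows "s \<epsilon> (\<epsilon>(v := 1)) + s (\<epsilon>(v := 1)) (\<epsilon>(v := 1, w := 1))
    = s \<epsilon> (\<epsilon>(w := 1)) + s (\<epsilon>(w := 1)) (\<epsilon>(v := 1, w := 1)) + 1"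
proof -
  have upd: "\<epsilon>(v := 1) \<in> bicolourings G" "\<epsilon>(w := 1) \<in> bicolourings G"
    using assms by (auto intro!: bicolouring_upd)
  have twist: "\<epsilon>(v := 1, w := 1) = \<epsilon>(w := 1, v := 1)" using assms by (simp add: fun_upd_twist)
  have "flips G \<epsilon> (\<epsilon>(v := 1))" "flips G \<epsilon> (\<epsilon>(w := 1))"
    "flips G (\<epsilon>(v := 1)) (\<epsilon>(v := 1, w := 1))"
    using assms upd unfolding flips_def by auto
  moreover have "flips G (\<epsilon>(w := 1)) (\<epsilon>(v := 1, w := 1))"
    unfolding twist flips_def using assms upd by auto
  moreover have "\<epsilon>(v := 1) \<noteq> \<epsilon>(w := 1)" using assms by (metis fun_upd_apply zero_neq_one)
  ultimately show ?thesis using assms(1) unfolding sign_assignment_def by blast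
qed

text \<open>
  Two successive flips at \<open>v\<close> and \<open>w\<close> lead to the component that contains \<open>x\<close>, in whichever order they
  are made; the square condition on signs makes the two orders cancel.
\<close>
lemma bold_diff_bold_diff:
  fixes c :: "'a generator \<Rightarrow>\<^sub>0 'k::field"
  assumes G: "pair_graph G" and s: "sign_assignment G s" and c: "c \<in> bold_chains G i"
  shows "bold_diff G s (bold_diff G s c) = 0"
proof -
  let ?D = "bold_diff G s :: ('a generator \<Rightarrow>\<^sub>0 'k) \<Rightarrow> _"
  have lin: "chain_linear ?D" unfolding bold_diff_eq by (rule linear_linear_extension)
  have "(?D \<circ> ?D) c = (\<lambda>_. 0) c"
  proof (rule chain_linear_eq_on_generators[OF Vector_Spaces.linear_compose[OF lin lin]
        chain.linear_zero _ c[unfolded bold_chains_eq]])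
    fix g assume g: "g \<in> generators G i"
    obtain \<epsilon> x where [simp]: "g = (\<epsilon>, x)" by (cases g)
    have \<epsilon>: "\<epsilon> \<in> bicolourings G" and x: "x \<in> components (coloured_subgraph G \<epsilon>)"
      using g by (auto simp: generators_iff)
    let ?Z = "{v \<in> pverts G. \<epsilon> v = 0}"
    define F where "F v w = Poly_Mapping.single
      (\<epsilon>(v := 1, w := 1), merge G (\<epsilon>(v := 1, w := 1)) x)
      (bit_sign (s \<epsilon> (\<epsilon>(v := 1))) * bit_sign (s (\<epsilon>(v := 1)) (\<epsilon>(v := 1, w := 1))) :: 'k)" for v w
    have "?D (Poly_Mapping.single (\<epsilon>(v := 1), merge G (\<epsilon>(v := 1)) x) (bit_sign (s \<epsilon> (\<epsilon>(v := 1)))))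
        = (\<Sum>w\<in>?Z - {v}. F v w)" if v: "v \<in> ?Z" for v
    proof -
      let ?y = "merge G (\<epsilon>(v := 1)) x"
      have up: "\<epsilon>(v := 1) \<in> bicolourings G" using \<epsilon> v by (intro bicolouring_upd) auto
      have y: "?y \<in> components (coloured_subgraph G (\<epsilon>(v := 1)))" "x \<subseteq> ?y"
        by (rule merge_component[OF G _ x]; simp)+
      have Z: "{w \<in> pverts G. (\<epsilon>(v := 1)) w = 0} = ?Z - {v}" by auto
      have "merge G (\<epsilon>(v := 1, w := 1)) ?y = merge G (\<epsilon>(v := 1, w := 1)) x" for w
      proof (rule sym, rule merge_eqI[OF G _ x])
        show "merge G (\<epsilon>(v := 1, w := 1)) ?y \<in> components (coloured_subgraph G (\<epsilon>(v := 1, w := 1)))"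
          by (rule merge_component(1)[OF G _ y(1)]) simp
        have "?y \<subseteq> merge G (\<epsilon>(v := 1, w := 1)) ?y"
          by (rule merge_component(2)[OF G _ y(1)]) simp
        then show "x \<subseteq> merge G (\<epsilon>(v := 1, w := 1)) ?y" using y(2) by blast
      qed simp
      then show ?thesis
        unfolding bold_diff_eq linear_extension_single bold_diff_gen_eq[OF G up y(1)] Z
        by (simp add: chain.scale_sum_right F_def)
    qed
    then have "(?D \<circ> ?D) (Poly_Mapping.single g 1) = (\<Sum>v\<in>?Z. \<Sum>w\<in>?Z - {v}. F v w)"
      by (simp add: bold_diff_eq bold_diff_gen_eq[OF G \<epsilon> x] chain.linear_sum[OF linear_linear_extension])
    also have "\<dots> = 0"
    proof (rule antisymmetric_double_sum)
      show "finite ?Z" using finite_pverts[OF G] by simp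
      fix v w assume vw: "v \<in> ?Z" "w \<in> ?Z" "v \<noteq> w"
      have twist: "\<epsilon>(w := 1, v := 1) = \<epsilon>(v := 1, w := 1)" using vw by (simp add: fun_upd_twist)
      have "s \<epsilon> (\<epsilon>(v := 1)) + s (\<epsilon>(v := 1)) (\<epsilon>(v := 1, w := 1))
        = s \<epsilon> (\<epsilon>(w := 1)) + s (\<epsilon>(w := 1)) (\<epsilon>(v := 1, w := 1)) + 1"
        using sign_assignmentD[OF s \<epsilon>] vw by simp
      then have "bit_sign (s \<epsilon> (\<epsilon>(v := 1)) + s (\<epsilon>(v := 1)) (\<epsilon>(v := 1, w := 1)))
        + bit_sign (s \<epsilon> (\<epsilon>(w := 1)) + s (\<epsilon>(w := 1)) (\<epsilon>(v := 1, w := 1))) = (0 :: 'k)"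
        by (intro bit_sign_opposite) (simp add: add.assoc[symmetric])
      then show "F v w + F w v = 0"
        unfolding F_def twist single_add[symmetric] bit_sign_add[symmetric] by (simp only: single_zero)
    qed
    finally show "(?D \<circ> ?D) (Poly_Mapping.single g 1) = 0" .
  qed
  then show ?thesis by simp
qed

section \<open>Comparing sign assignments\<close>

text \<open>
  The sum \<open>u\<close> of two sign assignments is a 1-cocycle on the cube of colourings: the two paths around
  each square have the same sum. The cube being contractible, \<open>u\<close> is a coboundary. The potential \<open>\<eta>\<close>
  is built one coordinate direction at a time: once it is known on the face where \<open>a\<close> has colour 0, its
  values on the opposite face are forced along the edges in direction \<open>a\<close>, and the squares that
  contain such an edge show that the remaining edges are respected.
\<close>
lemma sign_assignments_differ_by_coboundary:
  assumes fin: "finite (pverts G)" and s: "sign_assignment G s" and t: "sign_assignment G t"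
  obtains \<eta> where "\<And>\<epsilon> v. \<epsilon> \<in> bicolourings G \<Longrightarrow> v \<in> pverts G \<Longrightarrow> \<epsilon> v = 0 \<Longrightarrow>
    s \<epsilon> (\<epsilon>(v := 1)) = t \<epsilon> (\<epsilon>(v := 1)) + \<eta> \<epsilon> + \<eta> (\<epsilon>(v := 1))"
proof -
  define u where "u \<epsilon> \<epsilon>' = s \<epsilon> \<epsilon>' + t \<epsilon> \<epsilon>'" for \<epsilon> \<epsilon>'
  have square: "u \<epsilon> (\<epsilon>(v := 1)) + u (\<epsilon>(v := 1)) (\<epsilon>(v := 1, w := 1))
      = u \<epsilon> (\<epsilon>(w := 1)) + u (\<epsilon>(w := 1)) (\<epsilon>(v := 1, w := 1))"
    if "\<epsilon> \<in> bicolourings G" "v \<in> pverts G" "w \<in> pverts G" "\<epsilon> v = 0" "\<epsilon> w = 0" "v \<noteq> w" for \<epsilon> v w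
  proof -
    have bits: "(a + a') + (b + b') = (c + c') + (d + d')"
      if "a + b = c + d + 1" "a' + b' = c' + d' + 1" for a b c d a' b' c' d' :: bit
    proof -
      have "(a + a') + (b + b') = (a + b) + (a' + b')" by (simp only: ac_simps)
      also have "\<dots> = (c + c') + (d + d') + (1 + 1)" unfolding that by (simp only: ac_simps)
      also have "1 + 1 = (0 :: bit)" by simp
      finally show ?thesis by (simp only: add_0_right)
    qed
    show ?thesis
      unfolding u_def by (rule bits[OF sign_assignmentD[OF s that] sign_assignmentD[OF t that]])
  qed
  have "\<exists>\<eta>. \<forall>\<epsilon> \<in> bicolourings G. (\<forall>v \<in> pverts G - W. \<epsilon> v = 0) \<longrightarrow>
      (\<forall>v \<in> W. \<epsilon> v = 0 \<longrightarrow> \<eta> (\<epsilon>(v := 1)) = \<eta> \<epsilon> + u \<epsilon> (\<epsilon>(v := 1)))"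
    if "finite W" "W \<subseteq> pverts G" for W
    using that
  proof (induction W rule: finite_induct)
    case empty
    then show ?case by simp
  next
    case (insert a W)
    then obtain \<eta> where "\<forall>\<epsilon> \<in> bicolourings G. (\<forall>v \<in> pverts G - W. \<epsilon> v = 0) \<longrightarrow>
        (\<forall>v \<in> W. \<epsilon> v = 0 \<longrightarrow> \<eta> (\<epsilon>(v := 1)) = \<eta> \<epsilon> + u \<epsilon> (\<epsilon>(v := 1)))"
      by blast
    then have IH: "\<eta> (\<epsilon>(v := 1)) = \<eta> \<epsilon> + u \<epsilon> (\<epsilon>(v := 1))"
      if "\<epsilon> \<in> bicolourings G" "\<forall>v \<in> pverts G - W. \<epsilon> v = 0" "v \<in> W" "\<epsilon> v = 0" for \<epsilon> v
      using that by blast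
    define \<eta>' where "\<eta>' \<epsilon> = (if \<epsilon> a = 1 then \<eta> (\<epsilon>(a := 0)) + u (\<epsilon>(a := 0)) \<epsilon> else \<eta> \<epsilon>)" for \<epsilon>
    have "\<eta>' (\<epsilon>(v := 1)) = \<eta>' \<epsilon> + u \<epsilon> (\<epsilon>(v := 1))"
      if \<epsilon>: "\<epsilon> \<in> bicolourings G" "\<forall>v \<in> pverts G - insert a W. \<epsilon> v = 0"
        and v: "v \<in> insert a W" "\<epsilon> v = 0" for \<epsilon> v
    proof (cases "v = a")
      case True
      then have "\<epsilon>(v := 1, a := 0) = \<epsilon>" using v by auto
      then show ?thesis using True v by (simp add: \<eta>'_def)
    next
      case False
      then have vW: "v \<in> W" using v by auto
      have aV: "a \<in> pverts G" "v \<in> pverts G" using insert.prems vW by auto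
      from \<epsilon>(1) aV(1) show ?thesis
      proof (cases rule: bicolouring_cases)
        case 1
        then have "\<forall>v \<in> pverts G - W. \<epsilon> v = 0" using \<epsilon>(2) by auto
        then show ?thesis using IH[OF \<epsilon>(1) _ vW v(2)] 1 False by (simp add: \<eta>'_def)
      next
        case 2
        let ?\<delta> = "\<epsilon>(a := 0)"
        have \<delta>: "?\<delta> \<in> bicolourings G" using \<epsilon>(1) aV by (intro bicolouring_upd) auto
        have swap: "\<epsilon>(v := 1, a := 0) = ?\<delta>(v := 1)" "?\<delta>(a := 1) = \<epsilon>" "?\<delta>(v := 1, a := 1) = \<epsilon>(v := 1)"
          using False 2 by auto
        have "\<eta> (?\<delta>(v := 1)) = \<eta> ?\<delta> + u ?\<delta> (?\<delta>(v := 1))"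
          using \<epsilon>(2) v False by (intro IH[OF \<delta> _ vW]) auto
        moreover have "u ?\<delta> (?\<delta>(v := 1)) + u (?\<delta>(v := 1)) (\<epsilon>(v := 1)) = u ?\<delta> \<epsilon> + u \<epsilon> (\<epsilon>(v := 1))"
          using square[OF \<delta> aV(2,1)] v False unfolding swap by simp
        ultimately have "\<eta> (?\<delta>(v := 1)) + u (?\<delta>(v := 1)) (\<epsilon>(v := 1))
            = \<eta> ?\<delta> + u ?\<delta> \<epsilon> + u \<epsilon> (\<epsilon>(v := 1))"
          by (simp only: add.assoc)
        then show ?thesis using 2 False unfolding \<eta>'_def swap(1)[symmetric] by simp
      qed
    qed
    then show ?case by blast
  qed
  from this[OF fin order_refl] obtain \<eta> where "\<forall>\<epsilon> \<in> bicolourings G.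
      \<forall>v \<in> pverts G. \<epsilon> v = 0 \<longrightarrow> \<eta> (\<epsilon>(v := 1)) = \<eta> \<epsilon> + u \<epsilon> (\<epsilon>(v := 1))"
    by blast
  then have \<eta>: "\<eta> (\<epsilon>(v := 1)) = \<eta> \<epsilon> + u \<epsilon> (\<epsilon>(v := 1))"
    if "\<epsilon> \<in> bicolourings G" "v \<in> pverts G" "\<epsilon> v = 0" for \<epsilon> v
    using that by blast
  have bits: "b = a + (c + d) \<Longrightarrow> c = d + a + b" for a b c d :: bit
    by (cases a; cases b; cases c; cases d) simp_all
  show ?thesis
    using bits[OF \<eta>[unfolded u_def]] by (intro that)
qed

section \<open>Colourings of the cone\<close>

definition extend :: "('a \<Rightarrow> nat) \<Rightarrow> 'a option \<Rightarrow> nat" where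
  "extend \<delta> = case_option 0 \<delta>"

lemma extend_simps [simp]: "extend \<delta> None = 0" "extend \<delta> (Some v) = \<delta> v"
  by (simp_all add: extend_def)

lemma extend_upd: "extend (\<delta>(v := a)) = (extend \<delta>)(Some v := a)"
  by (auto simp: fun_eq_iff extend_def split: option.split)

lemma extend_inverse: "\<epsilon> None = 0 \<Longrightarrow> extend (\<epsilon> \<circ> Some) = \<epsilon>"
  by (auto simp: fun_eq_iff extend_def split: option.split)

lemma extend_comp_Some [simp]: "extend \<delta> \<circ> Some = \<delta>"
  by (simp add: fun_eq_iff)

lemma pverts_cone [simp]: "pverts (cone G) = insert None (Some ` pverts G)"
  by (simp add: cone_def)

lemma extend_bicolouring_iff: "extend \<delta> \<in> bicolourings (cone G) \<longleftrightarrow> \<delta> \<in> bicolourings G"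
proof -
  have "(\<forall>w. w \<notin> pverts (cone G) \<longrightarrow> extend \<delta> w = undefined) \<longleftrightarrow> (\<forall>v. v \<notin> pverts G \<longrightarrow> \<delta> v = undefined)"
    by (auto simp: extend_def split: option.split)
  then show ?thesis
    by (auto simp: bicolourings_def PiE_iff extensional_def)
qed

lemma sum_extend:
  assumes "finite (pverts G)"
  shows "(\<Sum>w \<in> pverts (cone G). extend \<delta> w) = (\<Sum>v \<in> pverts G. \<delta> v)"
  using assms by (simp add: sum.reindex)

lemma components_extend:
  assumes "pair_graph G"
  shows "components (coloured_subgraph (cone G) (extend \<delta>)) = (`) Some ` components (coloured_subgraph G \<delta>)"
proof (rule components_embedding)
  show "sym_digraph (coloured_subgraph G \<delta>)" "sym_digraph (coloured_subgraph (cone G) (extend \<delta>))"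
    using assms pair_graph_cone by (auto intro: sym_digraph_coloured_subgraph)
  show "verts (coloured_subgraph (cone G) (extend \<delta>)) = Some ` verts (coloured_subgraph G \<delta>)"
    by auto
  show "arcs_ends (coloured_subgraph (cone G) (extend \<delta>))
      = (\<lambda>(u, v). (Some u, Some v)) ` arcs_ends (coloured_subgraph G \<delta>)"
    unfolding arcs_ends_coloured_subgraph by (auto simp: cone_def)
qed simp

text \<open>
  The apex is adjacent to every other vertex, so a coloured subgraph that contains it is connected.
  This is why the colourings with apex colour 1 contribute one generator each, that is, a plain
  cube.
\<close>
lemma components_apex_coloured:
  assumes "pair_graph G" and "\<epsilon> None = 1"
  shows "components (coloured_subgraph (cone G) \<epsilon>) = {{v \<in> pverts (cone G). \<epsilon> v = 1}}"
proof -
  interpret sym_digraph "coloured_subgraph (cone G) \<epsilon>"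
    using assms(1) by (intro sym_digraph_coloured_subgraph pair_graph_cone)
  show ?thesis
    by (subst components_dominated[of None])
      (use assms(2) in \<open>auto simp: arcs_ends_coloured_subgraph cone_def\<close>)
qed

definition apex_generator :: "'a pair_pre_digraph \<Rightarrow> ('a option \<Rightarrow> nat) \<Rightarrow> 'a option generator" where
  "apex_generator G \<epsilon> = (\<epsilon>, {v \<in> pverts (cone G). \<epsilon> v = 1})"

definition apex_generators :: "'a pair_pre_digraph \<Rightarrow> nat \<Rightarrow> 'a option generator set" where
  "apex_generators G i = {g \<in> generators (cone G) i. fst g None = 1}"

lemma apex_generatorE:
  assumes "pair_graph G" and "g \<in> apex_generators G i"
  obtains \<epsilon> where "g = apex_generator G \<epsilon>" "\<epsilon> \<in> bicolourings (cone G)" "\<epsilon> None = 1"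
    "(\<Sum>v \<in> pverts (cone G). \<epsilon> v) = i"
proof -
  obtain \<epsilon> x where g: "g = (\<epsilon>, x)" by (cases g)
  have "\<epsilon> \<in> bicolourings (cone G)" "\<epsilon> None = 1" "(\<Sum>v \<in> pverts (cone G). \<epsilon> v) = i"
    "x \<in> components (coloured_subgraph (cone G) \<epsilon>)"
    using assms(2) unfolding g apex_generators_def by (auto simp: generators_iff simp del: pverts_cone)
  moreover from this have "x = {v \<in> pverts (cone G). \<epsilon> v = 1}"
    using components_apex_coloured[OF assms(1)] by blast
  ultimately show ?thesis using that g by (simp add: apex_generator_def)
qed

lemma apex_generator_mem:
  assumes "pair_graph G" and "\<epsilon> \<in> bicolourings (cone G)" "\<epsilon> None = 1"
    "(\<Sum>v \<in> pverts (cone G). \<epsilon> v) = i"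
  shows "apex_generator G \<epsilon> \<in> apex_generators G i"
  using assms components_apex_coloured[where \<epsilon> = \<epsilon>, OF assms(1,3)]
  by (auto simp: apex_generator_def apex_generators_def generators_iff simp del: pverts_cone)

text \<open>
  With apex colour 0 the coloured subgraph lies in the base, and the apex adds nothing to the degree.
\<close>
lemma base_generatorE:
  assumes "pair_graph G" and "g \<in> generators (cone G) i" and "g \<notin> apex_generators G i"
  obtains \<delta> x where "g = (extend \<delta>, Some ` x)" "(\<delta>, x) \<in> generators G i"
proof -
  obtain \<epsilon> y where g: "g = (\<epsilon>, y)" by (cases g)
  have \<epsilon>: "\<epsilon> \<in> bicolourings (cone G)" "(\<Sum>v \<in> pverts (cone G). \<epsilon> v) = i"
    "y \<in> components (coloured_subgraph (cone G) \<epsilon>)" "\<epsilon> None \<noteq> 1"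
    using assms(2,3) unfolding g apex_generators_def by (auto simp: generators_iff simp del: pverts_cone)
  have "\<epsilon> None = 0" using \<epsilon>(4) bicolouring_cases[OF \<epsilon>(1), of None] by auto
  then have ext: "\<epsilon> = extend (\<epsilon> \<circ> Some)" using extend_inverse by metis
  define \<delta> where "\<delta> = \<epsilon> \<circ> Some"
  have ed: "\<epsilon> = extend \<delta>" unfolding \<delta>_def by (rule ext)
  obtain x where x: "y = Some ` x" "x \<in> components (coloured_subgraph G \<delta>)"
    using \<epsilon>(3) unfolding ed components_extend[OF assms(1)] by blast
  have "(\<delta>, x) \<in> generators G i"
    using \<epsilon> x unfolding ed
    by (simp only: generators_iff extend_bicolouring_iff sum_extend[OF finite_pverts[OF assms(1)]])
  with that g ed x show ?thesis by blast
qed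

lemma base_generator_mem:
  assumes "pair_graph G" and "(\<delta>, x) \<in> generators G i"
  shows "(extend \<delta>, Some ` x) \<in> generators (cone G) i"
  using assms(2) unfolding generators_iff
  by (simp only: extend_bicolouring_iff sum_extend[OF finite_pverts[OF assms(1)]]
      components_extend[OF assms(1)] imageI simp_thms)

lemma merge_extend:
  assumes G: "pair_graph G" and "\<And>v. \<delta> v = 1 \<Longrightarrow> \<delta>' v = 1" and x: "x \<in> components (coloured_subgraph G \<delta>)"
  shows "merge (cone G) (extend \<delta>') (Some ` x) = Some ` merge G \<delta>' x"
proof (rule merge_eqI[OF pair_graph_cone[OF G]])
  note m = merge_component[of G \<delta> \<delta>' x, OF assms]
  show "Some ` x \<in> components (coloured_subgraph (cone G) (extend \<delta>))"
    "Some ` merge G \<delta>' x \<in> components (coloured_subgraph (cone G) (extend \<delta>'))"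
    unfolding components_extend[OF G] using x m(1) by blast+
  show "Some ` x \<subseteq> Some ` merge G \<delta>' x" using m(2) by (rule image_mono)
  show "extend \<delta>' v = 1" if "extend \<delta> v = 1" for v using that assms(2) by (cases v) auto
qed

section \<open>The subcomplex of colourings that contain the apex\<close>

lemma bold_diff_apex_generator:
  assumes G: "pair_graph G" and \<epsilon>: "\<epsilon> \<in> bicolourings (cone G)" "\<epsilon> None = 1"
  shows "bold_diff_gen (cone G) t (apex_generator G \<epsilon>) = (\<Sum>v \<in> {v \<in> pverts (cone G). \<epsilon> v = 0}.
    Poly_Mapping.single (apex_generator G (\<epsilon>(v := 1))) (bit_sign (t \<epsilon> (\<epsilon>(v := 1)))))"
  unfolding apex_generator_def
proof (subst bold_diff_gen_eq[OF pair_graph_cone[OF G] \<epsilon>(1)], goal_cases)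
  case 1
  show ?case using components_apex_coloured[where \<epsilon> = \<epsilon>, OF G \<epsilon>(2)] by simp
next
  case 2
  show ?case
  proof (rule sum.cong[OF refl])
    fix v assume v: "v \<in> {v \<in> pverts (cone G). \<epsilon> v = 0}"
    let ?x = "\<lambda>\<epsilon>. {v \<in> pverts (cone G). \<epsilon> v = 1}"
    have "merge (cone G) (\<epsilon>(v := 1)) (?x \<epsilon>) = ?x (\<epsilon>(v := 1))"
    proof (rule merge_eqI[OF pair_graph_cone[OF G]])
      show "?x \<epsilon> \<in> components (coloured_subgraph (cone G) \<epsilon>)"
        using components_apex_coloured[where \<epsilon> = \<epsilon>, OF G \<epsilon>(2)] by simp
      show "?x (\<epsilon>(v := 1)) \<in> components (coloured_subgraph (cone G) (\<epsilon>(v := 1)))"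
        using components_apex_coloured[where \<epsilon> = "\<epsilon>(v := 1)", OF G] \<epsilon>(2) v by (simp del: pverts_cone)
    qed auto
    then show "Poly_Mapping.single (\<epsilon>(v := 1), merge (cone G) (\<epsilon>(v := 1)) (?x \<epsilon>)) (bit_sign (t \<epsilon> (\<epsilon>(v := 1))))
      = Poly_Mapping.single (\<epsilon>(v := 1), ?x (\<epsilon>(v := 1))) (bit_sign (t \<epsilon> (\<epsilon>(v := 1))))"
      by (simp only:)
  qed
qed

text \<open>
  The contraction of the cube in the direction of a base vertex \<open>p\<close>: it switches \<open>p\<close> off. The sign is the
  one with which the differential switches \<open>p\<close> on again.
\<close>
definition apex_contraction_gen ::
  "'a pair_pre_digraph \<Rightarrow> (('a option \<Rightarrow> nat) \<Rightarrow> ('a option \<Rightarrow> nat) \<Rightarrow> bit) \<Rightarrow> 'a \<Rightarrow> 'a option generator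
     \<Rightarrow> ('a option generator \<Rightarrow>\<^sub>0 'k::field)" where
  "apex_contraction_gen G t p g = (let \<epsilon> = fst g; \<epsilon>' = \<epsilon>(Some p := 0) in
     if \<epsilon> (Some p) = 1 then Poly_Mapping.single (apex_generator G \<epsilon>') (bit_sign (t \<epsilon>' \<epsilon>)) else 0)"

lemma apex_contraction_gen_simps:
  "\<epsilon> (Some p) = 0 \<Longrightarrow> apex_contraction_gen G t p (apex_generator G \<epsilon>) = 0"
  "\<epsilon> (Some p) = 1 \<Longrightarrow> apex_contraction_gen G t p (apex_generator G \<epsilon>) =
     Poly_Mapping.single (apex_generator G (\<epsilon>(Some p := 0))) (bit_sign (t (\<epsilon>(Some p := 0)) \<epsilon>))"
  by (simp_all add: apex_contraction_gen_def apex_generator_def Let_def)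

text \<open>
  If \<open>p\<close> has colour 0, only the flip at \<open>p\<close> survives the contraction and it is undone. If \<open>p\<close> has
  colour 1, switching it off and on again gives the generator back, and the flips at the other
  vertices occur once before and once after the contraction; in the square spanned by \<open>p\<close> and \<open>v\<close> their
  signs are opposite. Hence the contraction is a homotopy between the identity and 0.
\<close>
lemma apex_contraction_homotopy:
  assumes G: "pair_graph G" and t: "sign_assignment (cone G) t" and p: "p \<in> pverts G"
    and c: "c \<in> chains_on (apex_generators G i)"
  shows "bold_diff (cone G) t (linear_extension (apex_contraction_gen G t p) c)
      + linear_extension (apex_contraction_gen G t p) (bold_diff (cone G) t c) = (c :: _ \<Rightarrow>\<^sub>0 'k::field)"
proof -
  let ?D = "bold_diff (cone G) t :: ('a option generator \<Rightarrow>\<^sub>0 'k) \<Rightarrow> _"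
  let ?h = "linear_extension (apex_contraction_gen G t p) :: ('a option generator \<Rightarrow>\<^sub>0 'k) \<Rightarrow> _"
  have lin: "chain_linear ?D" "chain_linear ?h"
    unfolding bold_diff_eq by (rule linear_linear_extension)+
  have "(\<lambda>c. (?D \<circ> ?h) c + (?h \<circ> ?D) c) c = id c"
  proof (rule chain_linear_eq_on_generators[OF _ chain.linear_id _ c])
    show "chain_linear (\<lambda>c. (?D \<circ> ?h) c + (?h \<circ> ?D) c)"
      by (intro chain.linear_compose_add Vector_Spaces.linear_compose[OF lin(1,2)]
          Vector_Spaces.linear_compose[OF lin(2,1)])
    fix g assume "g \<in> apex_generators G i"
    then obtain \<epsilon> where g: "g = apex_generator G \<epsilon>" and \<epsilon>: "\<epsilon> \<in> bicolourings (cone G)" "\<epsilon> None = 1"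
      by (rule apex_generatorE[OF G])
    let ?e = "apex_generator G"
    let ?P = "Some p"
    let ?Z = "\<lambda>\<epsilon>. {v \<in> pverts (cone G). \<epsilon> v = (0 :: nat)}"
    let ?s = "\<lambda>\<epsilon> \<epsilon>'. bit_sign (t \<epsilon> \<epsilon>') :: 'k"
    have P: "?P \<in> pverts (cone G)" using p by simp
    have fin: "finite (?Z \<epsilon>)" for \<epsilon> using finite_pverts[OF G] by simp
    have diff: "?D (Poly_Mapping.single (?e \<epsilon>) a)
        = (\<Sum>v\<in>?Z \<epsilon>. Poly_Mapping.single (?e (\<epsilon>(v := 1))) (a * ?s \<epsilon> (\<epsilon>(v := 1))))"
      if "\<epsilon> \<in> bicolourings (cone G)" "\<epsilon> None = 1" for \<epsilon> a
      by (simp add: bold_diff_eq bold_diff_apex_generator[OF G that] chain.scale_sum_right del: pverts_cone)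
    have hdiff: "?h (?D (Poly_Mapping.single g 1))
        = (\<Sum>v\<in>?Z \<epsilon>. scale (?s \<epsilon> (\<epsilon>(v := 1))) (apex_contraction_gen G t p (?e (\<epsilon>(v := 1)))))"
      unfolding g diff[OF \<epsilon>] by (simp add: chain.linear_sum[OF lin(2)])
    have "?D (?h (Poly_Mapping.single g 1)) + ?h (?D (Poly_Mapping.single g 1)) = Poly_Mapping.single g 1"
      using \<epsilon>(1) P
    proof (cases rule: bicolouring_cases)
      case 1
      have "?P \<in> ?Z \<epsilon>" using P 1 by simp
      moreover have "(\<Sum>v\<in>?Z \<epsilon> - {?P}. scale (?s \<epsilon> (\<epsilon>(v := 1)))
          (apex_contraction_gen G t p (?e (\<epsilon>(v := 1))))) = 0"
        using 1 by (intro sum.neutral) (auto simp: apex_contraction_gen_simps simp del: pverts_cone)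
      moreover have "\<epsilon>(?P := 1, ?P := 0) = \<epsilon>" using 1 by auto
      ultimately have "?h (?D (Poly_Mapping.single g 1)) = Poly_Mapping.single g 1"
        unfolding hdiff
        by (subst sum.remove[OF fin]) (auto simp: apex_contraction_gen_simps g simp del: pverts_cone)
      then show ?thesis using 1 by (simp add: g apex_contraction_gen_simps bold_diff_eq chain.linear_0[OF linear_linear_extension])
    next
      case 2
      let ?\<epsilon>' = "\<epsilon>(?P := 0)"
      have \<epsilon>0: "?\<epsilon>' \<in> bicolourings (cone G)" "?\<epsilon>' None = 1"
        using \<epsilon> P by (auto intro!: bicolouring_upd simp del: pverts_cone)
      have Z: "?Z ?\<epsilon>' = insert ?P (?Z \<epsilon>)" "?P \<notin> ?Z \<epsilon>" using P 2 by auto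
      have restore: "?\<epsilon>'(?P := 1) = \<epsilon>" using 2 by auto
      have "?D (?h (Poly_Mapping.single g 1)) = Poly_Mapping.single g 1
          + (\<Sum>v\<in>?Z \<epsilon>. Poly_Mapping.single (?e (?\<epsilon>'(v := 1))) (?s ?\<epsilon>' \<epsilon> * ?s ?\<epsilon>' (?\<epsilon>'(v := 1))))"
        using 2 unfolding g linear_extension_single apex_contraction_gen_simps(2)[of \<epsilon>, OF 2]
          scale_single mult_1_left diff[OF \<epsilon>0] Z(1) sum.insert[OF fin Z(2)] restore by simp
      moreover have "?h (?D (Poly_Mapping.single g 1))
          = (\<Sum>v\<in>?Z \<epsilon>. Poly_Mapping.single (?e (?\<epsilon>'(v := 1))) (?s \<epsilon> (\<epsilon>(v := 1)) * ?s (?\<epsilon>'(v := 1)) (\<epsilon>(v := 1))))"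
        unfolding hdiff
      proof (rule sum.cong[OF refl])
        fix v assume "v \<in> ?Z \<epsilon>"
        then have "v \<noteq> ?P" using Z(2) by blast
        then have "(\<epsilon>(v := 1)) ?P = 1" "\<epsilon>(v := 1, ?P := 0) = ?\<epsilon>'(v := 1)" using 2 by auto
        then show "scale (?s \<epsilon> (\<epsilon>(v := 1))) (apex_contraction_gen G t p (?e (\<epsilon>(v := 1))))
            = Poly_Mapping.single (?e (?\<epsilon>'(v := 1))) (?s \<epsilon> (\<epsilon>(v := 1)) * ?s (?\<epsilon>'(v := 1)) (\<epsilon>(v := 1)))"
          by (simp only: apex_contraction_gen_simps(2) scale_single)
      qed
      moreover have "?s ?\<epsilon>' \<epsilon> * ?s ?\<epsilon>' (?\<epsilon>'(v := 1)) + ?s \<epsilon> (\<epsilon>(v := 1)) * ?s (?\<epsilon>'(v := 1)) (\<epsilon>(v := 1)) = 0"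
        if "v \<in> ?Z \<epsilon>" for v
      proof -
        have v: "v \<noteq> ?P" "v \<in> pverts (cone G)" "?\<epsilon>' v = 0" using that Z(2) by auto
        have swap: "?\<epsilon>'(?P := 1, v := 1) = \<epsilon>(v := 1)" using restore by simp
        have bits: "(a + c) + (b + d) = 1" if "a + b = c + d + 1" for a b c d :: bit
          using that by (cases a; cases b; cases c; cases d) simp_all
        have "?\<epsilon>' ?P = 0" "?P \<noteq> v" using v(1) by auto
        then have "t ?\<epsilon>' \<epsilon> + t \<epsilon> (\<epsilon>(v := 1)) = t ?\<epsilon>' (?\<epsilon>'(v := 1)) + t (?\<epsilon>'(v := 1)) (\<epsilon>(v := 1)) + 1"
          by (rule sign_assignmentD[OF t \<epsilon>0(1) P v(2) _ v(3), unfolded swap restore])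
        then show ?thesis unfolding bit_sign_add[symmetric] by (intro bit_sign_opposite bits)
      qed
      ultimately show ?thesis
        by (simp add: add.assoc flip: sum.distrib single_add)
    qed
    then show "(\<lambda>c. (?D \<circ> ?h) c + (?h \<circ> ?D) c) (Poly_Mapping.single g 1) = id (Poly_Mapping.single g 1)"
      by simp
  qed
  then show ?thesis by simp
qed

lemma apex_contraction_chain:
  fixes c :: "'a option generator \<Rightarrow>\<^sub>0 'k::field"
  assumes G: "pair_graph G" and p: "p \<in> pverts G" and c: "c \<in> chains_on (apex_generators G (Suc i))"
  shows "linear_extension (apex_contraction_gen G t p) c \<in> chains_on (apex_generators G i)"
proof (rule linear_extension_mem[OF subspace_chains_on _ c])
  fix g assume "g \<in> apex_generators G (Suc i)"
  then obtain \<epsilon> where g: "g = apex_generator G \<epsilon>" and \<epsilon>: "\<epsilon> \<in> bicolourings (cone G)" "\<epsilon> None = 1"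
    "(\<Sum>v \<in> pverts (cone G). \<epsilon> v) = Suc i"
    by (rule apex_generatorE[OF G])
  have P: "Some p \<in> pverts (cone G)" using p by simp
  show "(apex_contraction_gen G t p g :: _ \<Rightarrow>\<^sub>0 'k) \<in> chains_on (apex_generators G i)"
    using \<epsilon>(1) P
  proof (cases rule: bicolouring_cases)
    case 1
    then show ?thesis by (simp add: g apex_contraction_gen_simps chain.subspace_0[OF subspace_chains_on])
  next
    case 2
    let ?\<epsilon>' = "\<epsilon>(Some p := 0)"
    have up: "?\<epsilon>'(Some p := 1) = \<epsilon>" using 2 by auto
    have "Suc (\<Sum>v \<in> pverts (cone G). ?\<epsilon>' v) = Suc i"
      using sum_colour_upd[where \<epsilon> = ?\<epsilon>', OF finite_pverts[OF pair_graph_cone[OF G]] P] \<epsilon>(3)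
      unfolding up by (simp del: pverts_cone)
    moreover have "?\<epsilon>' \<in> bicolourings (cone G)" "?\<epsilon>' None = 1"
      using \<epsilon> P by (auto intro!: bicolouring_upd simp del: pverts_cone)
    ultimately have "apex_generator G ?\<epsilon>' \<in> apex_generators G i"
      by (intro apex_generator_mem[OF G]) simp_all
    then show ?thesis unfolding g apex_contraction_gen_simps(2)[of \<epsilon>, OF 2] by (rule single_in_chains_on)
  qed
qed

text \<open>
  The apex itself has colour 1, so the subcomplex starts in degree 1.
\<close>
lemma apex_generators_0: "pair_graph G \<Longrightarrow> apex_generators G 0 = {}"
  using finite_pverts by (fastforce simp: apex_generators_def generators_def)


section \<open>Comparing the cone with its base\<close>

text \<open>
  The projection of the complex of the cone onto its quotient by the apex subcomplex, identified with
  the complex of the base. The sign \<open>\<eta>\<close> compensates for the two complexes being built from unrelated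
  sign assignments.
\<close>
definition restriction_gen :: "(('a \<Rightarrow> nat) \<Rightarrow> bit) \<Rightarrow> 'a option generator \<Rightarrow> ('a generator \<Rightarrow>\<^sub>0 'k::field)" where
  "restriction_gen \<eta> = (\<lambda>(\<epsilon>, x). if \<epsilon> None = 1 then 0
     else Poly_Mapping.single (\<epsilon> \<circ> Some, Some -` x) (bit_sign (\<eta> (\<epsilon> \<circ> Some))))"

text \<open>
  A section of the projection in each degree. It is not a chain map: the differential in the cone has
  an additional term in which the apex is switched on.
\<close>
definition extension_gen :: "(('a \<Rightarrow> nat) \<Rightarrow> bit) \<Rightarrow> 'a generator \<Rightarrow> ('a option generator \<Rightarrow>\<^sub>0 'k::field)" where
  "extension_gen \<eta> = (\<lambda>(\<delta>, x). Poly_Mapping.single (extend \<delta>, Some ` x) (bit_sign (\<eta> \<delta>)))"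

lemma restriction_gen_base [simp]:
  "restriction_gen \<eta> (extend \<delta>, Some ` x) = Poly_Mapping.single (\<delta>, x) (bit_sign (\<eta> \<delta>))"
  by (simp add: restriction_gen_def inj_vimage_image_eq)

lemma restriction_gen_apex: "fst g None = 1 \<Longrightarrow> restriction_gen \<eta> g = 0"
  by (simp add: restriction_gen_def case_prod_beta)

lemma restriction_extension:
  "linear_extension (restriction_gen \<eta>) (linear_extension (extension_gen \<eta>) c) = (c :: _ \<Rightarrow>\<^sub>0 'k::field)"
proof -
  have "(linear_extension (restriction_gen \<eta>) \<circ> linear_extension (extension_gen \<eta>)) c = id c"
  proof (rule chain_linear_eq_on_generators[OF Vector_Spaces.linear_compose[OF
          linear_linear_extension linear_linear_extension] chain.linear_id])
    show "c \<in> chains_on UNIV" by (simp add: chains_on_def)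
    fix g :: "'a generator"
    show "(linear_extension (restriction_gen \<eta>) \<circ> linear_extension (extension_gen \<eta>)) (Poly_Mapping.single g 1)
        = (id (Poly_Mapping.single g 1) :: _ \<Rightarrow>\<^sub>0 'k)"
      by (cases g) (simp add: extension_gen_def)
  qed
  then show ?thesis by simp
qed

lemma restriction_chain:
  fixes c :: "'a option generator \<Rightarrow>\<^sub>0 'k::field"
  assumes G: "pair_graph G" and c: "c \<in> bold_chains (cone G) i"
  shows "linear_extension (restriction_gen \<eta>) c \<in> bold_chains G i"
  unfolding bold_chains_eq
proof (rule linear_extension_mem[OF subspace_chains_on _ c[unfolded bold_chains_eq]])
  fix g assume g: "g \<in> generators (cone G) i"
  show "(restriction_gen \<eta> g :: _ \<Rightarrow>\<^sub>0 'k) \<in> chains_on (generators G i)"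
  proof (cases "g \<in> apex_generators G i")
    case True
    then show ?thesis
      by (simp add: apex_generators_def restriction_gen_apex chain.subspace_0[OF subspace_chains_on])
  next
    case False
    then show ?thesis
      using base_generatorE[OF G g] by (metis restriction_gen_base single_in_chains_on)
  qed
qed

lemma extension_chain:
  fixes c :: "'a generator \<Rightarrow>\<^sub>0 'k::field"
  assumes G: "pair_graph G" and c: "c \<in> bold_chains G i"
  shows "linear_extension (extension_gen \<eta>) c \<in> bold_chains (cone G) i"
  unfolding bold_chains_eq
proof (rule linear_extension_mem[OF subspace_chains_on _ c[unfolded bold_chains_eq]])
  fix g assume "g \<in> generators G i"
  then show "(extension_gen \<eta> g :: _ \<Rightarrow>\<^sub>0 'k) \<in> chains_on (generators (cone G) i)"
    using base_generator_mem[OF G] by (cases g) (auto simp: extension_gen_def intro: single_in_chains_on)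
qed

text \<open>
  Subtracting from \<open>c\<close> the section of its projection removes the generators with apex colour 0 and keeps
  the apex generators. A chain with projection 0 is unchanged by this, so it consists of apex
  generators only.
\<close>
lemma restriction_kernel:
  fixes c :: "'a option generator \<Rightarrow>\<^sub>0 'k::field"
  assumes G: "pair_graph G" and c: "c \<in> bold_chains (cone G) i"
    and ker: "linear_extension (restriction_gen \<eta>) c = 0"
  shows "c \<in> chains_on (apex_generators G i)"
proof -
  let ?r = "linear_extension (restriction_gen \<eta>) :: (_ \<Rightarrow>\<^sub>0 'k) \<Rightarrow> _"
  let ?x = "linear_extension (extension_gen \<eta>) :: (_ \<Rightarrow>\<^sub>0 'k) \<Rightarrow> _"
  define \<pi> :: "'a option generator \<Rightarrow> 'a option generator \<Rightarrow>\<^sub>0 'k"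
    where "\<pi> g = (if g \<in> apex_generators G i then Poly_Mapping.single g 1 else 0)" for g
  have "id c - (?x \<circ> ?r) c = linear_extension \<pi> c"
  proof (rule chain_linear_eq_on_generators[OF _ linear_linear_extension _ c[unfolded bold_chains_eq]])
    show "chain_linear (\<lambda>c. id c - (?x \<circ> ?r) c)"
      by (intro chain.linear_compose_sub chain.linear_id Vector_Spaces.linear_compose[OF
            linear_linear_extension linear_linear_extension])
    fix g assume g: "g \<in> generators (cone G) i"
    show "id (Poly_Mapping.single g 1) - (?x \<circ> ?r) (Poly_Mapping.single g 1)
        = linear_extension \<pi> (Poly_Mapping.single g 1)"
    proof (cases "g \<in> apex_generators G i")
      case True
      then have "(restriction_gen \<eta> g :: _ \<Rightarrow>\<^sub>0 'k) = 0"
        by (simp add: apex_generators_def restriction_gen_apex)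
      then show ?thesis using True by (simp add: \<pi>_def chain.linear_0[OF linear_linear_extension])
    next
      case False
      then obtain \<delta> x where "g = (extend \<delta>, Some ` x)" using base_generatorE[OF G g] by metis
      then show ?thesis using False by (simp add: \<pi>_def extension_gen_def)
    qed
  qed
  then have "c = linear_extension \<pi> c"
    by (simp add: ker chain.linear_0[OF linear_linear_extension])
  moreover have "linear_extension \<pi> c \<in> chains_on (apex_generators G i)"
    by (rule linear_extension_mem[OF subspace_chains_on _ c[unfolded bold_chains_eq]])
      (auto simp: \<pi>_def single_in_chains_on chain.subspace_0[OF subspace_chains_on])
  ultimately show ?thesis by simp
qed

text \<open>
  On an apex generator both sides vanish, because the apex keeps colour 1. On a generator extended from
  the base, the flip at the apex is killed by the projection and the other flips are those of the
  base, with signs that differ by the coboundary of \<open>\<eta>\<close>.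
\<close>
lemma restriction_chain_map:
  fixes c :: "'a option generator \<Rightarrow>\<^sub>0 'k::field"
  assumes G: "pair_graph G"
    and \<eta>: "\<And>\<delta> v. \<delta> \<in> bicolourings G \<Longrightarrow> v \<in> pverts G \<Longrightarrow> \<delta> v = 0 \<Longrightarrow>
      s \<delta> (\<delta>(v := 1)) = t (extend \<delta>) (extend (\<delta>(v := 1))) + \<eta> \<delta> + \<eta> (\<delta>(v := 1))"
    and c: "c \<in> bold_chains (cone G) i"
  shows "linear_extension (restriction_gen \<eta>) (bold_diff (cone G) t c)
    = bold_diff G s (linear_extension (restriction_gen \<eta>) c)"
proof -
  let ?r = "linear_extension (restriction_gen \<eta>) :: (_ \<Rightarrow>\<^sub>0 'k) \<Rightarrow> _"
  have lin: "chain_linear ?r" by (rule linear_linear_extension)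
  have "(?r \<circ> bold_diff (cone G) t) c = (bold_diff G s \<circ> ?r) c"
    unfolding bold_diff_eq
  proof (rule chain_linear_eq_on_generators[OF Vector_Spaces.linear_compose[OF linear_linear_extension
            linear_linear_extension] Vector_Spaces.linear_compose[OF linear_linear_extension
            linear_linear_extension] _ c[unfolded bold_chains_eq]])
    fix g assume g: "g \<in> generators (cone G) i"
    have "?r (bold_diff_gen (cone G) t g) = linear_extension (bold_diff_gen G s) (restriction_gen \<eta> g)"
    proof (cases "g \<in> apex_generators G i")
      case True
      then obtain \<epsilon> where \<epsilon>: "g = apex_generator G \<epsilon>" "\<epsilon> \<in> bicolourings (cone G)" "\<epsilon> None = 1"
        by (rule apex_generatorE[OF G])
      have "restriction_gen \<eta> (apex_generator G (\<epsilon>(v := 1))) = (0 :: _ \<Rightarrow>\<^sub>0 'k)" for v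
        using \<epsilon>(3) by (intro restriction_gen_apex) (simp add: apex_generator_def)
      then have "?r (bold_diff_gen (cone G) t g) = 0"
        unfolding \<epsilon>(1) bold_diff_apex_generator[OF G \<epsilon>(2,3)] by (simp add: chain.linear_sum[OF lin])
      moreover have "(restriction_gen \<eta> g :: _ \<Rightarrow>\<^sub>0 'k) = 0"
        using \<epsilon>(1,3) by (intro restriction_gen_apex) (simp add: apex_generator_def)
      ultimately show ?thesis by (simp add: chain.linear_0[OF linear_linear_extension])
    next
      case False
      with g obtain \<delta> x where gx: "g = (extend \<delta>, Some ` x)" and "(\<delta>, x) \<in> generators G i"
        by (rule base_generatorE[OF G])
      then have \<delta>: "\<delta> \<in> bicolourings G" and x: "x \<in> components (coloured_subgraph G \<delta>)"
        by (simp_all add: generators_iff)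
      have ext: "extend \<delta> \<in> bicolourings (cone G)"
        "Some ` x \<in> components (coloured_subgraph (cone G) (extend \<delta>))"
        using \<delta> x by (simp_all add: extend_bicolouring_iff components_extend[OF G])
      let ?Z = "{v \<in> pverts G. \<delta> v = 0}"
      let ?f = "\<lambda>w. Poly_Mapping.single ((extend \<delta>)(w := 1), merge (cone G) ((extend \<delta>)(w := 1)) (Some ` x))
          (bit_sign (t (extend \<delta>) ((extend \<delta>)(w := 1)))) :: _ \<Rightarrow>\<^sub>0 'k"
      have fin: "finite ?Z" using finite_pverts[OF G] by simp
      have "{w \<in> pverts (cone G). extend \<delta> w = 0} = insert None (Some ` ?Z)" by auto
      then have "bold_diff_gen (cone G) t g = ?f None + (\<Sum>v\<in>?Z. ?f (Some v))"
        unfolding gx bold_diff_gen_eq[OF pair_graph_cone[OF G] ext]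
        using fin by (simp add: sum.reindex)
      moreover have "?r (?f None) = 0" by (simp add: restriction_gen_apex)
      moreover have "?r (?f (Some v)) = scale (bit_sign (\<eta> \<delta>))
          (Poly_Mapping.single (\<delta>(v := 1), merge G (\<delta>(v := 1)) x) (bit_sign (s \<delta> (\<delta>(v := 1)))))"
        if v: "v \<in> ?Z" for v
      proof -
        have m: "merge (cone G) (extend (\<delta>(v := 1))) (Some ` x) = Some ` merge G (\<delta>(v := 1)) x"
          by (rule merge_extend[OF G _ x]) simp
        have "bit_sign (t (extend \<delta>) (extend (\<delta>(v := 1)))) * bit_sign (\<eta> (\<delta>(v := 1)))
            = (bit_sign (\<eta> \<delta>) * bit_sign (s \<delta> (\<delta>(v := 1))) :: 'k)"
          using \<eta>[OF \<delta>, of v] v by (simp add: bit_sign_def)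
        then show ?thesis
          unfolding extend_upd[symmetric] m linear_extension_single restriction_gen_base by simp
      qed
      ultimately show ?thesis
        by (simp add: gx chain.linear_add[OF lin] chain.linear_sum[OF lin] chain.scale_sum_right
            bold_diff_gen_eq[OF G \<delta> x])
    qed
    then show "(?r \<circ> linear_extension (bold_diff_gen (cone G) t)) (Poly_Mapping.single g 1)
        = (linear_extension (bold_diff_gen G s) \<circ> ?r) (Poly_Mapping.single g 1)"
      by simp
  qed
  then show ?thesis by simp
qed

lemma sign_assignment_restrict:
  assumes t: "sign_assignment (cone G) t"
  shows "sign_assignment G (\<lambda>\<delta> \<delta>'. t (extend \<delta>) (extend \<delta>'))"
proof -
  have "flips (cone G) (extend \<delta>) (extend \<delta>')" if "flips G \<delta> \<delta>'" for \<delta> \<delta>'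
    using that unfolding flips_def by (auto simp: extend_bicolouring_iff extend_upd)
  moreover have "extend \<delta> \<noteq> extend \<delta>'" if "\<delta> \<noteq> \<delta>'" for \<delta> \<delta>' :: "'a \<Rightarrow> nat"
    using that extend_comp_Some by metis
  ultimately show ?thesis using t unfolding sign_assignment_def by blast
qed

theorem proposition5p3:
  fixes G :: "'a pair_pre_digraph"
    and s :: "('a \<Rightarrow> nat) \<Rightarrow> ('a \<Rightarrow> nat) \<Rightarrow> bit"
    and t :: "('a option \<Rightarrow> nat) \<Rightarrow> ('a option \<Rightarrow> nat) \<Rightarrow> bit"
  assumes "pair_graph G" and "connected G"
    and "sign_assignment G s" and "sign_assignment (cone G) t"
  shows "graded_isomorphic
           (bold_homology (cone G) t
              :: nat \<Rightarrow> ('k::field, ('a option generator \<Rightarrow>\<^sub>0 'k) set) vec_space)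
           (bold_homology G s
              :: nat \<Rightarrow> ('k, ('a generator \<Rightarrow>\<^sub>0 'k) set) vec_space)"
proof -
  note G = assms(1) and t = assms(4)
  obtain p where p: "p \<in> pverts G"
    using assms(2) by (auto simp: connected_conv)
  obtain \<eta> where \<eta>: "\<And>\<delta> v. \<delta> \<in> bicolourings G \<Longrightarrow> v \<in> pverts G \<Longrightarrow> \<delta> v = 0 \<Longrightarrow>
      s \<delta> (\<delta>(v := 1)) = t (extend \<delta>) (extend (\<delta>(v := 1))) + \<eta> \<delta> + \<eta> (\<delta>(v := 1))"
    using sign_assignments_differ_by_coboundary[OF finite_pverts[OF G] assms(3)
        sign_assignment_restrict[OF t]] by blast
  let ?r = "linear_extension (restriction_gen \<eta>) :: ('a option generator \<Rightarrow>\<^sub>0 'k) \<Rightarrow> _"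
  let ?h = "linear_extension (apex_contraction_gen G t p) :: ('a option generator \<Rightarrow>\<^sub>0 'k) \<Rightarrow> _"
  let ?D = "bold_diff (cone G) t :: ('a option generator \<Rightarrow>\<^sub>0 'k) \<Rightarrow> _"
  have "linear_iso
      (quotient_space {c \<in> bold_chains (cone G) i. ?D c = 0}
        (case i of 0 \<Rightarrow> {0} | Suc j \<Rightarrow> ?D ` bold_chains (cone G) j))
      (quotient_space {c \<in> bold_chains G i. bold_diff G s c = 0}
        (case i of 0 \<Rightarrow> {0} | Suc j \<Rightarrow> bold_diff G s ` bold_chains G j))
      ((`) ?r)" for i
  proof (rule linear_iso_homology[where C = "bold_chains (cone G)" and C' = "bold_chains G"
        and D = ?D and D' = "bold_diff G s" and \<phi> = ?r])
    show "chain_linear ?D" "chain_linear (bold_diff G s)" "chain_linear ?r"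
      unfolding bold_diff_eq by (rule linear_linear_extension)+
    show "chain.subspace (bold_chains (cone G) i :: ('a option generator \<Rightarrow>\<^sub>0 'k) set)" for i
      unfolding bold_chains_eq by (rule subspace_chains_on)
    show "?D c \<in> bold_chains (cone G) (Suc i)" if "c \<in> bold_chains (cone G) i" for i c
      using bold_diff_chain[OF pair_graph_cone[OF G] that] .
    show "?D (?D c) = 0" if "c \<in> bold_chains (cone G) i" for i c
      using bold_diff_bold_diff[OF pair_graph_cone[OF G] t that] .
    show "?r ` bold_chains (cone G) i = bold_chains G i" for i
    proof (intro equalityI subsetI)
      fix c :: "'a generator \<Rightarrow>\<^sub>0 'k" assume "c \<in> bold_chains G i"
      then show "c \<in> ?r ` bold_chains (cone G) i"
        by (intro image_eqI[of _ _ "linear_extension (extension_gen \<eta>) c"] extension_chain[OF G])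
          (simp_all add: restriction_extension)
    qed (auto intro: restriction_chain[OF G])
    show "?r (?D c) = bold_diff G s (?r c)" if "c \<in> bold_chains (cone G) i" for i c
      using restriction_chain_map[OF G \<eta> that] .
    show "c = 0" if "c \<in> bold_chains (cone G) 0" "?r c = 0" for c
      using restriction_kernel[OF G that] by (simp add: apex_generators_0[OF G] chains_on_def)
    show "\<exists>k \<in> bold_chains (cone G) i. ?r k = 0 \<and> ?D k = c"
      if c: "c \<in> bold_chains (cone G) (Suc i)" "?r c = 0" "?D c = 0" for i c
    proof (intro bexI conjI)
      have apex: "c \<in> chains_on (apex_generators G (Suc i))" by (rule restriction_kernel[OF G c(1,2)])
      have k: "?h c \<in> chains_on (apex_generators G i)" by (rule apex_contraction_chain[OF G p apex])
      then show "?h c \<in> bold_chains (cone G) i"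
        by (auto simp: bold_chains_eq chains_on_def apex_generators_def)
      have "?r (?h c) \<in> {0}"
        by (rule linear_extension_mem[OF _ _ k]) (auto simp: apex_generators_def restriction_gen_apex)
      then show "?r (?h c) = 0" by simp
      show "?D (?h c) = c"
        using apex_contraction_homotopy[OF G t p apex] c(3)
        by (simp add: chain.linear_0[OF linear_linear_extension])
    qed
  qed
  then show ?thesis
    unfolding graded_isomorphic_def bold_homology_def bold_cycles_def bold_boundaries_def by blast
qed

end
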